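(* Let $\lambda_1,\dots,\lambda_n$ be distinct points in $\mathbb{D}$, let $W_1,\dots,W_n$ be $2\times 2$ complex matrices such that $(W_j)_{11}(W_j)_{22}\neq\det W_j$ for each $j$, and let $(x_{1j},x_{2j},x_{3j})=((W_j)_{11},(W_j)_{22},\det W_j)$ for each $j$. The following three conditions are equivalent. (1) There exists an analytic $2\times 2$ matrix function $F$ on $\mathbb{D}$ such that $F(\lambda_j)=W_j$ for $j=1,\dots,n$ and $\mu_{\mathrm{Diag}}(F(\lambda))\le 1$ for all $\lambda\in\mathbb{D}$. (2) There exists a rational function $x:\mathbb{D}\to\overline{\mathcal{E}}$ such that $x(\lambda_j)=(x_{1j},x_{2j},x_{3j})$ for $j=1,\dots,n$. (3) For some distinct points $z_1,z_2,z_3$ in $\mathbb{D}$ (with $x_{2j}z_k\neq 1$ for all $j,k$), there exist positive $3n$-square matrices $N=[N_{il,jk}]_{i,j=1,\,l,k=1}^{n,3}$ of rank at most $1$ and $M=[M_{il,jk}]_{i,j=1,\,l,k=1}^{n,3}$ such that $$\left[1-\overline{\frac{z_lx_{3i}-x_{1i}}{x_{2i}z_l-1}}\,\frac{z_kx_{3j}-x_{1j}}{x_{2j}z_k-1}\right]\ \ge\ \left[(1-\overline{z_l}z_k)N_{il,jk}\right]+\left[(1-\overline{\lambda_i}\lambda_j)M_{il,jk}\right].$$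
   Context: $\mathbb{D}$ is the open unit disc in $\mathbb{C}$. The closed tetrablock is $\overline{\mathcal{E}}=\{(x_1,x_2,x_3)\in\mathbb{C}^3:1-x_1z-x_2w+x_3zw\neq 0\text{ for all }z,w\in\mathbb{D}\}$. $\mathrm{Diag}$ is the set of diagonal matrices in $\mathbb{C}^{2\times 2}$, and for $A\in\mathbb{C}^{2\times2}$, $\mu_{\mathrm{Diag}}(A)=\left(\inf\{\|X\|:X\in\mathrm{Diag},\ 1-AX\text{ is singular}\}\right)^{-1}$, where $\|\cdot\|$ is the operator norm (with $\inf\emptyset=\infty$, $\infty^{-1}=0$). A "positive" matrix means a positive semidefinite Hermitian matrix. The $3n$-square matrices are indexed by pairs: rows by $(i,l)$ and columns by $(j,k)$ with $1\le i,j\le n$, $1\le l,k\le 3$. For Hermitian matrices, $P\ge Q$ means $P-Q$ is positive semidefinite. A rational function into $\mathbb{C}^3$ is one whose three components are rational functions. *)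

theory Defs
  imports "HOL-Complex_Analysis.Complex_Analysis"
begin

definition closed_tetrablock :: "(complex^3) set" where
  "closed_tetrablock =
     {x. \<forall>z\<in>ball 0 1. \<forall>w\<in>ball 0 1. 1 - x$1 * z - x$2 * w + x$3 * z * w \<noteq> 0}"

definition Diag :: "(complex^2^2) set" where
  "Diag = {X. \<forall>i j. i \<noteq> j \<longrightarrow> X$i$j = 0}"

(* Computed in ennreal, where Inf {} = top and inverse top = 0, so that the
   conventions for an empty infimum hold.  The type complex^2 carries the
   Euclidean norm, so onorm is the usual operator norm. *)
definition mu_Diag :: "complex^2^2 \<Rightarrow> ennreal" where
  "mu_Diag A =
     inverse (INF X\<in>{X\<in>Diag. \<not> invertible (mat 1 - A ** X)}. ennreal (onorm ((*v) X)))"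

definition analytic_matrix_on :: "(complex \<Rightarrow> complex^'n^'m) \<Rightarrow> complex set \<Rightarrow> bool" where
  "analytic_matrix_on F S \<longleftrightarrow> (\<forall>i j. (\<lambda>z. F z $ i $ j) analytic_on S)"

(* The values on S are those of quotients of polynomials without poles in S;
   nothing is said about x outside S. *)
definition rational_vector_on :: "(complex \<Rightarrow> complex^'n) \<Rightarrow> complex set \<Rightarrow> bool" where
  "rational_vector_on x S \<longleftrightarrow>
     (\<forall>i. \<exists>p q. \<forall>z\<in>S. poly q z \<noteq> 0 \<and> x z $ i = poly p z / poly q z)"

definition hermitian :: "complex^'n^'n \<Rightarrow> bool" where
  "hermitian A \<longleftrightarrow> (\<forall>i j. A$i$j = cnj (A$j$i))"

(* For Hermitian A the form below is real-valued, so taking Re loses nothing. *)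
definition positive_matrix :: "complex^'n^'n \<Rightarrow> bool" where
  "positive_matrix A \<longleftrightarrow>
     hermitian A \<and> (\<forall>v::complex^'n. 0 \<le> Re (\<Sum>i\<in>UNIV. \<Sum>j\<in>UNIV. cnj (v$i) * A$i$j * v$j))"

definition loewner_ge :: "complex^'n^'n \<Rightarrow> complex^'n^'n \<Rightarrow> bool" where
  "loewner_ge P Q \<longleftrightarrow> hermitian P \<and> hermitian Q \<and> positive_matrix (P - Q)"

end

(* From (1) to (3): put h = x1 x2 - x3, restrict to a circle |z| = r on which h has no
   zero, and rescale.  Then h = b c with b, c analytic on the closed disc and |b| = |c| on
   the circle, and pointwise on the circle the tetrablock condition forces the matrix
   S = [[x1, b], [c, x2]] to be a contraction.  Hence the kernel
   (1 - S(w)^* S(z)) / (1 - cnj w z) is positive on the points pt j; a subsequence of the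
   values b (pt j), c (pt j) converges as r tends to 1, so this survives with r = 1.
   Compressing the kernel by the vectors (1, z_k g_jk) with g_jk = c_j / (1 - x2_j z_k) gives
   (3) with equality.

   From (3) to (2): write N, M and the slack as Gram matrices.  The inequality says that
   (1, z_k g_jk, pt_j v_jk) |-> (Psi_jk, g_jk, v_jk) extends to a contraction U.  Then
   det (1 - U diag (s, t, z I)) is a polynomial, affine in s and in t, without zeros for
   s, t, z in the disc; divided by its value at s = t = 0 it is
   1 - x1 s - x2 t + x3 s t for a rational x.  For each j three values of t determine the
   linear fractional map t |-> (x1 - x3 t) / (1 - x2 t).

   From (2) to (1): only the product of the off-diagonal entries is prescribed, so one of them
   can be any nonvanishing interpolant. *)
theory Submission
  imports Defs
begin

unbundle no fps_syntax

section \<open>Contractions and positive kernels from tetrablock-valued functions\<close>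

text \<open>Only the product \<open>b * c\<close> is prescribed by the data, while contractivity of
  \<open>S\<close> rests on \<open>b\<close> and \<open>c\<close> having equal modulus on the
  circle. Splitting h by a square root is obstructed by its zeros, and at radius 1 by the absence of
  boundary values. Inside a zero-free smaller circle finitely many zeros remain, and each linear
  factor has an explicit balanced splitting. Since only values at the nodes matter afterwards,
  compactness in finite dimension replaces convergence of functions. Rank one of N makes its Gram
  vectors scalars, so that t occupies a single coordinate of the determinant; this is why the
  determinant is affine in t. Three points \<open>z k\<close> appear because equality of two linear
  fractional maps is a quadratic equation. The assumption x1 x2 \<noteq> x3 acts in three places: it
  keeps h from vanishing identically, it makes the coefficients of the linear fractional map
  recoverable from its values, and it makes the upper right entry of every W nonzero.\<close>

lemma Szego_reproducing:
  assumes f: "f analytic_on cball 0 1" and w: "norm w < 1"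
  shows "((\<lambda>t. cnj (1 / (1 - cnj w * circlepath 0 1 t)) * f (circlepath 0 1 t))
           has_integral f w) {0..1}"
proof -
  let ?e = "circlepath 0 1"
  have "((\<lambda>u. f u / (u - w)) has_contour_integral (2 * of_real pi * \<i> * f w)) ?e"
    using f w by (intro Cauchy_integral_circlepath_simple) (auto simp: analytic_imp_holomorphic)
  then have "((\<lambda>t. f (?e t) / (?e t - w) * vector_derivative ?e (at t within {0..1}))
      has_integral (2 * of_real pi * \<i> * f w)) {0..1}"
    by (simp add: has_contour_integral_def)
  then have *: "((\<lambda>t. 1 / (2 * of_real pi * \<i>) *
        (f (?e t) / (?e t - w) * vector_derivative ?e (at t within {0..1})))
      has_integral (1 / (2 * of_real pi * \<i>) * (2 * of_real pi * \<i> * f w))) {0..1}"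
    by (rule has_integral_mult_right)
  \<comment> \<open>With u = exp (2 pi i t) one has du = 2 pi i u dt and u - w = u (1 - w cnj u), so
    Cauchy's integrand turns into the conjugated Szego kernel times \<open>f\<close>.\<close>
  have eq: "1 / (2 * of_real pi * \<i>) *
        (f (?e t) / (?e t - w) * vector_derivative ?e (at t within {0..1})) =
      cnj (1 / (1 - cnj w * ?e t)) * f (?e t)" if t: "t \<in> {0..1}" for t
  proof -
    define e where "e = ?e t"
    have e: "e = exp (2 * of_real pi * \<i> * of_real t)"
      by (simp add: e_def circlepath)
    have n: "norm e = 1" using e by (simp add: norm_exp_eq_Re)
    then have ce: "cnj e * e = 1"
      by (simp add: complex_norm_square [symmetric] mult.commute)
    have "e - w \<noteq> 0" using n w by auto
    moreover have "e * (1 - w * cnj e) = e - w" using ce by (simp add: algebra_simps)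
    ultimately have "f e / (e - w) * e = f e / (1 - w * cnj e)"
      by (metis (no_types, lifting) mult.commute mult_eq_0_iff nonzero_mult_divide_mult_cancel_left times_divide_eq_left)
    moreover have "vector_derivative ?e (at t within {0..1}) = 2 * of_real pi * \<i> * e"
      using vector_derivative_circlepath01 [of t 0 1] t by (simp add: e)
    ultimately have "1 / (2 * of_real pi * \<i>) * (f e / (e - w) * vector_derivative ?e (at t within {0..1})) =
        f e / (e - w) * e"
      by (simp add: field_simps)
    then show ?thesis
      using \<open>f e / (e - w) * e = f e / (1 - w * cnj e)\<close> by (simp add: e_def)
  qed
  show ?thesis
    using has_integral_eq [OF eq *] by simp
qed

(* A substitute for inner-outer factorization: both factors carry half of the outer part. *)
definition balanced_factorable :: "(complex \<Rightarrow> complex) \<Rightarrow> bool" where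
  "balanced_factorable h \<longleftrightarrow>
     (\<exists>b c. b analytic_on cball 0 1 \<and> c analytic_on cball 0 1 \<and>
       (\<forall>z\<in>cball 0 1. h z = b z * c z) \<and> (\<forall>z\<in>sphere 0 1. norm (b z) = norm (c z)))"

lemma balanced_factorable_mult:
  assumes "balanced_factorable g" "balanced_factorable h"
  shows "balanced_factorable (\<lambda>z. g z * h z)"
proof -
  obtain b c where 1: "b analytic_on cball 0 1" "c analytic_on cball 0 1"
    "\<forall>z\<in>cball 0 1. g z = b z * c z" "\<forall>z\<in>sphere 0 1. norm (b z) = norm (c z)"
    using assms(1) by (auto simp: balanced_factorable_def)
  obtain b' c' where 2: "b' analytic_on cball 0 1" "c' analytic_on cball 0 1"
    "\<forall>z\<in>cball 0 1. h z = b' z * c' z" "\<forall>z\<in>sphere 0 1. norm (b' z) = norm (c' z)"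
    using assms(2) by (auto simp: balanced_factorable_def)
  show ?thesis
    unfolding balanced_factorable_def
    using 1 2
    by (intro exI [of _ "\<lambda>z. b z * b' z"] exI [of _ "\<lambda>z. c z * c' z"])
       (auto intro!: analytic_intros simp: norm_mult)
qed

text \<open>On the unit circle z - a and 1 - cnj a z have equal modulus. A square root
  \<open>?c\<close> of the latter therefore balances the splitting (z - a) / \<open>?c\<close> times
  \<open>?c\<close>. The principal root is analytic because 1 - cnj a z stays in the right
  half-plane.\<close>

lemma balanced_factorable_linear:
  assumes a: "norm a < 1"
  shows "balanced_factorable (\<lambda>z. z - a)"
proof -
  let ?c = "\<lambda>z. csqrt (1 - cnj a * z)"
  have pos: "0 < Re (1 - cnj a * z)" if "z \<in> cball 0 1" for z
  proof -
    have "Re (cnj a * z) \<le> norm a * norm z"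
      using complex_Re_le_cmod [of "cnj a * z"] by (simp add: norm_mult)
    also have "\<dots> \<le> norm a * 1"
      using that by (intro mult_left_mono) auto
    finally show ?thesis using a by simp
  qed
  have an: "?c analytic_on cball 0 1"
  proof (intro analytic_intros)
    show "1 - cnj a * z \<notin> \<real>\<^sub>\<le>\<^sub>0" if "z \<in> cball 0 1" for z
      using pos [OF that] by (metis complex_nonpos_Reals_iff not_le)
  qed
  have nz: "?c z \<noteq> 0" if "z \<in> cball 0 1" for z
    using pos [OF that] by (metis csqrt_eq_0 zero_complex.sel(1) less_irrefl)
  have "norm ((z - a) / ?c z) = norm (?c z)" if z: "z \<in> sphere 0 1" for z
  proof -
    have n: "cnj z * z = 1"
      using z by (simp add: complex_norm_square [symmetric] mult.commute)
    have "norm (?c z) * norm (?c z) = norm (1 - cnj a * z)"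
      by (metis norm_mult power2_csqrt power2_eq_square)
    also have "norm (1 - cnj a * z) = norm (cnj (z - a) * z)"
      using n by (simp add: algebra_simps)
    also have "\<dots> = norm (z - a)"
      using z by (simp only: norm_mult complex_mod_cnj) auto
    finally have "norm (?c z) * norm (?c z) = norm (z - a)" .
    then have "norm (z - a) = norm (?c z) * norm (?c z)" by (rule sym)
    moreover have "norm (?c z) \<noteq> 0" using nz [of z] z by (metis mem_sphere_0 mem_cball_0 norm_eq_zero order_refl)
    ultimately show ?thesis
      unfolding norm_divide by (metis nonzero_mult_div_cancel_right)
  qed
  then show ?thesis
    unfolding balanced_factorable_def
    using an nz
    by (intro exI [of _ "\<lambda>z. (z - a) / ?c z"] exI [of _ ?c]) (auto intro!: analytic_intros)
qed

text \<open>A zero-free function has an analytic square root on a slightly larger disc, and the root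
  serves as both factors.\<close>

lemma balanced_factorable_nonzero:
  assumes h: "h analytic_on cball 0 1" and nz: "\<And>z. z \<in> cball 0 1 \<Longrightarrow> h z \<noteq> 0"
  shows "balanced_factorable h"
proof -
  obtain U where U: "open U" "cball 0 1 \<subseteq> U" "h holomorphic_on U"
    using h by (auto simp: analytic_on_holomorphic)
  define V where "V = {z\<in>U. h z \<noteq> 0}"
  have "V = U \<inter> h -` (- {0})" by (auto simp: V_def)
  then have "open V"
    using continuous_open_preimage [OF holomorphic_on_imp_continuous_on [OF U(3)] U(1), of "- {0}"]
    by (simp add: open_Compl)
  moreover have "cball 0 1 \<subseteq> V" using U nz by (auto simp: V_def)
  ultimately obtain e where e: "e > 0" "(\<Union>x\<in>cball (0::complex) 1. ball x e) \<subseteq> V"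
    using compact_subset_open_imp_ball_epsilon_subset [of "cball (0::complex) 1" V] by auto
  have sub: "ball 0 (1 + e) \<subseteq> V"
  proof
    fix z :: complex assume z: "z \<in> ball 0 (1 + e)"
    show "z \<in> V"
    proof (cases "norm z \<le> 1")
      case True then show ?thesis using \<open>cball 0 1 \<subseteq> V\<close> by auto
    next
      case False
      \<comment> \<open>The radial projection of \<open>z\<close> to the circle is at distance norm
        z - 1 < e.\<close>
      have "dist (sgn z) z = norm (sgn z - z)" by (simp add: dist_norm)
      also have "sgn z - z = of_real (1 - norm z) * sgn z"
        using False by (auto simp: sgn_div_norm scaleR_conv_of_real divide_simps algebra_simps)
      also have "norm \<dots> < e"
        using False z by (simp only: norm_mult norm_sgn norm_of_real) auto
      finally have "z \<in> ball (sgn z) e" by simp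
      moreover have "sgn z \<in> cball 0 1" by (simp add: norm_sgn)
      ultimately show ?thesis using e by blast
    qed
  qed
  obtain g where g: "g holomorphic_on ball 0 (1 + e)" "\<And>z. z \<in> ball 0 (1 + e) \<Longrightarrow> h z = g z ^ 2"
  proof (rule contractible_imp_holomorphic_sqrt)
    show "h holomorphic_on ball 0 (1 + e)"
      using sub by (intro holomorphic_on_subset [OF U(3)]) (auto simp: V_def)
    show "contractible (ball (0::complex) (1 + e))"
      by (simp add: convex_imp_contractible)
    show "h z \<noteq> 0" if "z \<in> ball 0 (1 + e)" for z using sub that by (auto simp: V_def)
  qed blast
  have "g analytic_on cball 0 1"
    unfolding analytic_on_holomorphic using g(1) e(1) by (intro exI [of _ "ball 0 (1 + e)"]) auto
  then show ?thesis
    unfolding balanced_factorable_def using g(2) e(1)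
    by (intro exI [of _ g]) (auto simp: power2_eq_square)
qed

lemma balanced_factorable_power:
  assumes "balanced_factorable h"
  shows "balanced_factorable (\<lambda>z. h z ^ n)"
proof (induction n)
  case 0
  show ?case by (rule balanced_factorable_nonzero) auto
next
  case (Suc n)
  then show ?case using balanced_factorable_mult [OF assms] by simp
qed

text \<open>The zero is divided out with its full order, so that the quotient does not vanish at
  \<open>a\<close>. Since \<open>S\<close> need not be open, analyticity of the quotient is checked
  point by point: by the local factorization at \<open>a\<close>, by division elsewhere.\<close>

lemma analytic_factor_zero:
  assumes f: "f analytic_on S" and fin: "finite {z\<in>S. f z = 0}" and a: "a \<in> interior S" "f a = 0"
  obtains g n where "g analytic_on S" "\<And>z. z \<in> S \<Longrightarrow> f z = (z - a) ^ n * g z" "g a \<noteq> 0"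
proof -
  let ?Z = "{z\<in>S. f z = 0}"
  obtain r where r: "r > 0" "ball a r \<subseteq> interior S"
    using a(1) open_contains_ball [of "interior S"] by auto
  then have rS: "ball a r \<subseteq> S" using interior_subset by blast
  have hol: "f holomorphic_on ball a r"
    using f rS analytic_imp_holomorphic analytic_on_subset by blast
  \<comment> \<open>A constant would have to be 0, giving infinitely many zeros; so the zero has
    finite order.\<close>
  have "\<not> f constant_on ball a r"
  proof
    assume "f constant_on ball a r"
    then have "ball a r \<subseteq> ?Z" using a(2) r(1) rS unfolding constant_on_def by force
    then have "finite (ball a r)" using fin finite_subset by blast
    then show False using r(1) using uncountable_ball countable_finite by blast
  qed
  then obtain g s n where g: "0 < n" "0 < s" "ball a s \<subseteq> ball a r" "g holomorphic_on ball a s"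
    "\<And>w. w \<in> ball a s \<Longrightarrow> f w = (w - a) ^ n * g w" "\<And>w. w \<in> ball a s \<Longrightarrow> g w \<noteq> 0"
    using holomorphic_factor_zero_nonconstant [OF hol open_ball connected_ball, of a] a(2) r(1)
    by (metis centre_in_ball)
  define G where "G z = (if z = a then g a else f z / (z - a) ^ n)" for z
  have Gg: "G z = g z" if "z \<in> ball a s" for z
    using g(5) [OF that] by (auto simp: G_def)
  have "G analytic_on {z}" if z: "z \<in> S" for z
  proof (cases "z = a")
    case True
    have "G holomorphic_on ball a s" using g(4) Gg by (metis (no_types, lifting) holomorphic_cong)
    then show ?thesis using True g(2) by (meson analytic_at centre_in_ball open_ball)
  next
    case False
    have "(\<lambda>z. f z / (z - a) ^ n) analytic_on {z}"
      using False z f by (intro analytic_intros) (auto intro: analytic_on_subset)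
    moreover have "\<forall>\<^sub>F w in nhds z. w \<noteq> a"
      using False by (rule t1_space_nhds)
    then have "\<forall>\<^sub>F w in nhds z. f w / (w - a) ^ n = G w"
      by eventually_elim (auto simp: G_def)
    ultimately show ?thesis using analytic_at_cong [OF _ refl] by fast
  qed
  then have "G analytic_on S" using analytic_on_analytic_at by blast
  moreover have "f z = (z - a) ^ n * G z" for z using a(2) g(1) by (auto simp: G_def)
  moreover have "G a \<noteq> 0" using g(2,6) by (auto simp: G_def)
  ultimately show thesis using that by blast
qed

text \<open>Induction on the number of distinct zeros: removing one zero with its whole multiplicity
  lowers the count, and a zero-free function is left at the end.\<close>

lemma balanced_factorable_analytic:
  assumes h: "h analytic_on cball 0 1" and fin: "finite {z\<in>cball 0 1. h z = 0}"
    and nz: "\<And>z. z \<in> sphere 0 1 \<Longrightarrow> h z \<noteq> 0"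
  shows "balanced_factorable h"
  using assms
proof (induction "card {z\<in>cball 0 1. h z = 0}" arbitrary: h rule: less_induct)
  case less
  show ?case
  proof (cases "{z\<in>cball 0 1. h z = 0} = {}")
    case True
    then show ?thesis using less.prems(1) by (intro balanced_factorable_nonzero) blast+
  next
    case False
    then obtain a where a: "a \<in> cball 0 1" "h a = 0" by auto
    then have na: "norm a < 1" using less.prems(3) [of a] by fastforce
    obtain g n where g: "g analytic_on cball 0 1"
      "\<And>z. z \<in> cball 0 1 \<Longrightarrow> h z = (z - a) ^ n * g z" "g a \<noteq> 0"
      using analytic_factor_zero [OF less.prems(1,2), of a] a na by auto
    have sub: "{z\<in>cball 0 1. g z = 0} \<subset> {z\<in>cball 0 1. h z = 0}"
      using g a by force
    have "balanced_factorable g"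
    proof (rule less.hyps)
      show "card {z\<in>cball 0 1. g z = 0} < card {z\<in>cball 0 1. h z = 0}"
        using sub less.prems(2) by (rule psubset_card_mono [rotated])
      show "finite {z\<in>cball 0 1. g z = 0}"
        using sub less.prems(2) by (meson finite_subset psubset_imp_subset)
      show "g z \<noteq> 0" if "z \<in> sphere 0 1" for z
        using less.prems(3) [OF that] g(2) [of z] that by auto
    qed (rule g(1))
    then have "balanced_factorable (\<lambda>z. (z - a) ^ n * g z)"
      by (intro balanced_factorable_mult balanced_factorable_power balanced_factorable_linear na)
    then show ?thesis
      using g(2) unfolding balanced_factorable_def by auto
  qed
qed

section \<open>Contractivity of 2 x 2 matrices with balanced off-diagonal entries\<close>

lemma aligning_rotation:
  fixes s t :: complex
  obtains u where "norm u = 1" "norm (s + t * u) = norm s + norm t"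
proof
  let ?u = "cis (Arg s - Arg t)"
  show "norm ?u = 1" by simp
  have "t * ?u = rcis (norm t) (Arg t) * ?u" by (simp add: rcis_cmod_Arg)
  also have "\<dots> = of_real (norm t) * cis (Arg s)" by (simp add: rcis_def cis_mult mult.assoc)
  finally have "s + t * ?u = rcis (norm s) (Arg s) + of_real (norm t) * cis (Arg s)"
    by (simp add: rcis_cmod_Arg)
  also have "\<dots> = of_real (norm s + norm t) * cis (Arg s)"
    by (simp add: rcis_def algebra_simps)
  also have "norm \<dots> = norm s + norm t" by (simp only: norm_mult norm_of_real) simp
  finally show "norm (s + t * ?u) = norm s + norm t" .
qed

lemma norm_square_matrix_apply:
  fixes a b c d u v :: complex
  shows "(norm (a * u + b * v))\<^sup>2 + (norm (c * u + d * v))\<^sup>2 =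
    ((norm a)\<^sup>2 + (norm c)\<^sup>2) * (norm u)\<^sup>2 + ((norm b)\<^sup>2 + (norm d)\<^sup>2) * (norm v)\<^sup>2
     + 2 * Re ((cnj a * b + cnj c * d) * (cnj u * v))"
  unfolding cmod_power2 by (simp add: power2_eq_square algebra_simps)

text \<open>For S = [[a, b], [c, d]] both sides equal det (1 - S^* S): the left is the determinant
  written out, the right is 1 minus the squared Frobenius norm plus |det S|^2.\<close>

lemma defect_determinant:
  fixes a b c d :: complex
  shows "(1 - (norm a)\<^sup>2 - (norm c)\<^sup>2) * (1 - (norm b)\<^sup>2 - (norm d)\<^sup>2) - (norm (cnj a * b + cnj c * d))\<^sup>2
    = 1 - (norm a)\<^sup>2 - (norm b)\<^sup>2 - (norm c)\<^sup>2 - (norm d)\<^sup>2 + (norm (a * d - b * c))\<^sup>2"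
  unfolding cmod_power2 by (simp add: power2_eq_square algebra_simps)

text \<open>The hypotheses say that 1 - S^* S has nonnegative diagonal and determinant. The
  determinant bounds the cross term by the geometric mean of the diagonal entries, and 2xy \<le> x^2
  + y^2 then gives positivity.\<close>

lemma contraction_of_defect:
  fixes a b c d u v :: complex
  assumes p: "0 \<le> 1 - (norm a)\<^sup>2 - (norm c)\<^sup>2" and q: "0 \<le> 1 - (norm b)\<^sup>2 - (norm d)\<^sup>2"
    and det: "0 \<le> 1 - (norm a)\<^sup>2 - (norm b)\<^sup>2 - (norm c)\<^sup>2 - (norm d)\<^sup>2 + (norm (a * d - b * c))\<^sup>2"
  shows "(norm (a * u + b * v))\<^sup>2 + (norm (c * u + d * v))\<^sup>2 \<le> (norm u)\<^sup>2 + (norm v)\<^sup>2"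
proof -
  define P where "P = 1 - (norm a)\<^sup>2 - (norm c)\<^sup>2"
  define Q where "Q = 1 - (norm b)\<^sup>2 - (norm d)\<^sup>2"
  define R where "R = cnj a * b + cnj c * d"
  have PQ: "0 \<le> P" "0 \<le> Q" using p q by (auto simp: P_def Q_def)
  have "(norm R)\<^sup>2 \<le> P * Q"
    using defect_determinant [of a c b d] det by (simp add: P_def Q_def R_def)
  then have R: "norm R \<le> sqrt P * sqrt Q"
    by (metis real_le_rsqrt real_sqrt_mult)
  have "Re (R * (cnj u * v)) \<le> norm R * (norm u * norm v)"
    using complex_Re_le_cmod [of "R * (cnj u * v)"] by (simp add: norm_mult)
  also have "\<dots> \<le> (sqrt P * sqrt Q) * (norm u * norm v)"
    using R by (intro mult_right_mono) auto
  finally have "2 * Re (R * (cnj u * v)) \<le> 2 * (sqrt P * norm u) * (sqrt Q * norm v)"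
    by (simp only: mult_ac)
  also have "\<dots> \<le> (sqrt P * norm u)\<^sup>2 + (sqrt Q * norm v)\<^sup>2"
    by (rule sum_squares_bound)
  also have "\<dots> = P * (norm u)\<^sup>2 + Q * (norm v)\<^sup>2"
    using PQ by (simp add: power_mult_distrib)
  finally show ?thesis
    unfolding norm_square_matrix_apply by (simp add: P_def Q_def R_def algebra_simps)
qed

(* With s = b c: the image of the unit disc under w |-> a + s w / (1 - d w) is the disc of
   centre a + s cnj d / (1 - |d|^2) and radius |s| / (1 - |d|^2), and it lies in the unit disc. *)
lemma disc_bound_of_nonvanishing:
  fixes a d s :: complex
  assumes nv: "\<And>z w. norm z \<le> 1 \<Longrightarrow> norm w \<le> 1 \<Longrightarrow> 1 - a * z - d * w + (a * d - s) * z * w \<noteq> 0"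
  shows "norm d < 1" "norm (a * (1 - (norm d)\<^sup>2) + s * cnj d) + norm s \<le> 1 - (norm d)\<^sup>2"
proof -
  show d: "norm d < 1"
  proof (rule ccontr)
    assume "\<not> norm d < 1"
    then have "norm (1 / d) \<le> 1" "d \<noteq> 0" by (auto simp: norm_divide divide_simps)
    then show False using nv [of 0 "1 / d"] by simp
  qed
  define m where "m = 1 - (norm d)\<^sup>2"
  have m: "m > 0" using d by (simp add: m_def power_less_one_iff abs_square_less_1)
  have dd: "d * cnj d = 1 - of_real m" by (simp add: m_def complex_norm_square [symmetric])
  define k where "k = a * of_real m + s * cnj d"
  \<comment> \<open>\<open>k\<close> / m is the centre of the image disc and |s| / m its radius;
    \<open>u\<close> points to the point of the disc farthest from 0.\<close>
  obtain u where u: "norm u = 1" "norm (k + s * u) = norm k + norm s"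
    using aligning_rotation by blast
  have cu: "u * cnj u = 1" using u by (simp add: complex_norm_square [symmetric])
  have du: "1 + d * u \<noteq> 0"
  proof
    assume "1 + d * u = 0"
    then have "d * u = - 1" by (simp add: eq_neg_iff_add_eq_0 add.commute)
    then have "norm (d * u) = 1" by simp
    then show False using d u by (simp add: norm_mult)
  qed
  \<comment> \<open>This is the unimodular parameter with a + s w / (1 - d w) = (k + s u) / m, that
    is, the one mapped to the farthest point.\<close>
  define w where "w = (u + cnj d) / (1 + d * u)"
  have "u * cnj (1 + d * u) = u + cnj d * (u * cnj u)" by (simp add: algebra_simps)
  also have "\<dots> = u + cnj d" using cu by simp
  finally have "norm (u + cnj d) = norm u * norm (cnj (1 + d * u))"
    by (metis norm_mult)
  then have w: "norm w \<le> 1" using u du by (simp only: w_def norm_divide complex_mod_cnj) simp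
  have eq: "(1 - d * w) * (1 + d * u) = of_real m"
  proof -
    have "w * (1 + d * u) = u + cnj d" using du by (simp add: w_def)
    then have "(1 - d * w) * (1 + d * u) = 1 - d * cnj d"
      by (simp add: algebra_simps) (metis distrib_left mult.left_commute)
    then show ?thesis using dd by simp
  qed
  have "norm (k + s * u) \<le> m"
  proof (rule ccontr)
    assume "\<not> norm (k + s * u) \<le> m"
    then have n: "norm (k + s * u) > m" by simp
    then have nz: "k + s * u \<noteq> 0" using m by auto
    \<comment> \<open>The reciprocal of the image point: the polynomial factors as (1 - d w) (1 - z
      (a + s w / (1 - d w))), so an image point outside the unit disc produces a zero in the closed
      bidisc.\<close>
    define z where "z = of_real m / (k + s * u)"
    have "norm z \<le> 1" using n nz m by (simp add: z_def norm_divide divide_simps)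
    have "(1 + d * u) * (1 - a * z - d * w + (a * d - s) * z * w) =
       (1 - d * w) * (1 + d * u) - z * (a * ((1 - d * w) * (1 + d * u)) + s * (w * (1 + d * u)))"
      by (simp add: algebra_simps)
    also have "w * (1 + d * u) = u + cnj d" using du by (simp add: w_def)
    also have "a * ((1 - d * w) * (1 + d * u)) + s * (u + cnj d) = k + s * u"
      unfolding eq by (simp add: k_def algebra_simps)
    finally have "(1 + d * u) * (1 - a * z - d * w + (a * d - s) * z * w) = 0"
      using eq nz by (simp add: z_def)
    then show False using nv [OF \<open>norm z \<le> 1\<close> w] du by simp
  qed
  then show "norm (a * (1 - (norm d)\<^sup>2) + s * cnj d) + norm s \<le> 1 - (norm d)\<^sup>2"
    using u by (simp add: k_def m_def)
qed

text \<open>Balance gives |b c| = |b|^2 = |c|^2, so the radius term of the disc bound, used for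
  \<open>d\<close> and for \<open>a\<close>, controls the two diagonal entries of the defect. The
  disc bound squared and divided by 1 - |d|^2 is exactly the determinant condition.\<close>

lemma balanced_contraction_strict:
  fixes a b c d :: complex
  assumes nv: "\<And>z w. norm z \<le> 1 \<Longrightarrow> norm w \<le> 1 \<Longrightarrow> 1 - a * z - d * w + (a * d - b * c) * z * w \<noteq> 0"
    and bc: "norm b = norm c"
  shows "(norm (a * u + b * v))\<^sup>2 + (norm (c * u + d * v))\<^sup>2 \<le> (norm u)\<^sup>2 + (norm v)\<^sup>2"
proof (rule contraction_of_defect)
  have nv': "1 - d * z - a * w + (d * a - b * c) * z * w \<noteq> 0" if "norm z \<le> 1" "norm w \<le> 1" for z w
    using nv [OF that(2,1)] by (simp add: algebra_simps)
  define B where "B = (norm b)\<^sup>2"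
  define m where "m = 1 - (norm d)\<^sup>2"
  have Bc: "(norm c)\<^sup>2 = B" "norm (b * c) = B"
    using bc by (simp_all add: B_def norm_mult power2_eq_square)
  note D = disc_bound_of_nonvanishing [OF nv]
  note A = disc_bound_of_nonvanishing [OF nv']
  have "norm (b * c) \<le> 1 - (norm a)\<^sup>2"
    by (rule order_trans [OF _ A(2)]) simp
  then show "0 \<le> 1 - (norm a)\<^sup>2 - (norm c)\<^sup>2" using Bc by simp
  have "norm (b * c) \<le> 1 - (norm d)\<^sup>2"
    by (rule order_trans [OF _ D(2)]) simp
  then show "0 \<le> 1 - (norm b)\<^sup>2 - (norm d)\<^sup>2" using Bc by (simp add: B_def)
  have m: "m > 0" using D(1) by (simp add: m_def power_less_one_iff abs_square_less_1)
  have "norm (a * of_real m + b * c * cnj d) \<le> m - B"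
    using D(2) Bc(2) by (simp add: m_def)
  then have "(norm (a * of_real m + b * c * cnj d))\<^sup>2 \<le> (m - B)\<^sup>2"
    by (intro power_mono) auto
  also have "(norm (a * of_real m + b * c * cnj d))\<^sup>2 =
     m * (m * (norm a)\<^sup>2) + m * (2 * Re (a * d * cnj (b * c))) + (norm (b * c))\<^sup>2 * (norm d)\<^sup>2"
    unfolding cmod_power2 by (simp add: power2_eq_square algebra_simps)
  finally have "m * (m * (norm a)\<^sup>2) + m * (2 * Re (a * d * cnj (b * c))) + B\<^sup>2 * (1 - m) \<le> (m - B)\<^sup>2"
    unfolding Bc(2) by (simp add: m_def)
  then have "m * (m * (norm a)\<^sup>2 + 2 * Re (a * d * cnj (b * c))) \<le> m * (m - 2 * B + B\<^sup>2)"
    by (simp add: power2_eq_square algebra_simps)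
  then have le: "m * (norm a)\<^sup>2 + 2 * Re (a * d * cnj (b * c)) \<le> m - 2 * B + B\<^sup>2"
    using m by simp
  have "(norm (a * d - b * c))\<^sup>2 = (norm a)\<^sup>2 * (norm d)\<^sup>2 - 2 * Re (a * d * cnj (b * c)) + (norm (b * c))\<^sup>2"
    unfolding cmod_power2 by (simp add: power2_eq_square algebra_simps)
  then show "0 \<le> 1 - (norm a)\<^sup>2 - (norm b)\<^sup>2 - (norm c)\<^sup>2 - (norm d)\<^sup>2 + (norm (a * d - b * c))\<^sup>2"
    using le unfolding Bc by (simp add: B_def [symmetric] m_def algebra_simps)
qed

text \<open>Multiplying the matrix by t < 1 replaces z, w by t z, t w, which turns nonvanishing on
  the open bidisc into nonvanishing on the closed one. The estimate for every x = t^2 < 1 then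
  yields the limit case.\<close>

lemma balanced_contraction:
  fixes a b c d :: complex
  assumes nv: "\<And>z w. norm z < 1 \<Longrightarrow> norm w < 1 \<Longrightarrow> 1 - a * z - d * w + (a * d - b * c) * z * w \<noteq> 0"
    and bc: "norm b = norm c"
  shows "(norm (a * u + b * v))\<^sup>2 + (norm (c * u + d * v))\<^sup>2 \<le> (norm u)\<^sup>2 + (norm v)\<^sup>2"
proof (rule field_le_mult_one_interval)
  fix x :: real assume x: "0 < x" "x < 1"
  define t where "t = sqrt x"
  have t: "0 < t" "t < 1" using x by (auto simp: t_def)
  let ?t = "complex_of_real t"
  have tz: "norm (?t * z) < 1" if "norm z \<le> 1" for z
    using that t by (simp add: norm_mult) (meson le_less_trans mult_left_le less_imp_le)
  have "(norm (?t * a * u + ?t * b * v))\<^sup>2 + (norm (?t * c * u + ?t * d * v))\<^sup>2 \<le> (norm u)\<^sup>2 + (norm v)\<^sup>2"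
  proof (rule balanced_contraction_strict)
    fix z w :: complex assume "norm z \<le> 1" "norm w \<le> 1"
    then have "1 - a * (?t * z) - d * (?t * w) + (a * d - b * c) * (?t * z) * (?t * w) \<noteq> 0"
      by (intro nv tz)
    then show "1 - ?t * a * z - ?t * d * w + (?t * a * (?t * d) - ?t * b * (?t * c)) * z * w \<noteq> 0"
      by (simp add: algebra_simps)
  qed (simp add: norm_mult bc)
  moreover have "norm (?t * p * u + ?t * q * v) = t * norm (p * u + q * v)" for p q
  proof -
    have "?t * p * u + ?t * q * v = ?t * (p * u + q * v)" by (simp add: algebra_simps)
    then show ?thesis using t by (simp only: norm_mult norm_of_real abs_of_pos)
  qed
  ultimately have "t\<^sup>2 * (norm (a * u + b * v))\<^sup>2 + t\<^sup>2 * (norm (c * u + d * v))\<^sup>2 \<le> (norm u)\<^sup>2 + (norm v)\<^sup>2"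
    by (simp only: power_mult_distrib)
  then show "x * ((norm (a * u + b * v))\<^sup>2 + (norm (c * u + d * v))\<^sup>2) \<le> (norm u)\<^sup>2 + (norm v)\<^sup>2"
    using x by (simp add: t_def distrib_left)
qed

(* The quadratic form of the block matrix (1 - S_i^* S_j) / (1 - cnj p_i p_j), where
   S_i = [[a_i, b_i], [c_i, d_i]], at the vectors (s_i, t_i). *)
definition pick_form ::
    "('n::finite \<Rightarrow> complex) \<Rightarrow> ('n \<Rightarrow> complex) \<Rightarrow> ('n \<Rightarrow> complex) \<Rightarrow> ('n \<Rightarrow> complex) \<Rightarrow>
     ('n \<Rightarrow> complex) \<Rightarrow> ('n \<Rightarrow> complex) \<Rightarrow> ('n \<Rightarrow> complex) \<Rightarrow> complex" where
  "pick_form p a b c d s t =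
     (\<Sum>i\<in>UNIV. \<Sum>j\<in>UNIV.
        (cnj (s i) * s j + cnj (t i) * t j
          - cnj (a i * s i + b i * t i) * (a j * s j + b j * t j)
          - cnj (c i * s i + d i * t i) * (c j * s j + d j * t j)) / (1 - cnj (p i) * p j))"

lemma one_minus_cnj_mult_nonzero:
  fixes w z :: complex
  assumes "norm w < 1" "norm z \<le> 1"
  shows "1 - cnj w * z \<noteq> 0"
proof
  assume "1 - cnj w * z = 0"
  then have "norm (cnj w * z) = 1" by simp
  moreover have "norm w * norm z \<le> norm w * 1" using assms by (intro mult_left_mono) auto
  ultimately show False using assms by (simp add: norm_mult)
qed

(* With Szego kernels k_j, g = sum_j cnj (s_j, t_j) k_j and u = sum_j cnj (S_j (s_j, t_j)) k_j,
   the form is the integral of |g - S^T u|^2 + |u|^2 - |S^T u|^2 over the circle. *)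
lemma pick_form_nonneg:
  fixes p s t :: "'n::finite \<Rightarrow> complex"
  assumes an: "A analytic_on cball 0 1" "B analytic_on cball 0 1"
      "C analytic_on cball 0 1" "D analytic_on cball 0 1"
    and contr: "\<And>z u v. z \<in> sphere 0 1 \<Longrightarrow>
      (norm (A z * u + C z * v))\<^sup>2 + (norm (B z * u + D z * v))\<^sup>2 \<le> (norm u)\<^sup>2 + (norm v)\<^sup>2"
    and p: "\<And>i. norm (p i) < 1"
  shows "0 \<le> Re (pick_form p (\<lambda>i. A (p i)) (\<lambda>i. B (p i)) (\<lambda>i. C (p i)) (\<lambda>i. D (p i)) s t)"
proof -
  let ?e = "circlepath 0 1"
  define k where "k i z = 1 / (1 - cnj (p i) * z)" for i z
  define G where "G r z = (\<Sum>j\<in>UNIV. cnj (r j) * k j z)" for r :: "'n \<Rightarrow> complex" and z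
  have Gan: "G r analytic_on cball 0 1" for r
    unfolding G_def k_def
    by (intro analytic_intros) (use p one_minus_cnj_mult_nonzero in auto)
  have int: "((\<lambda>x. cnj (G r (?e x)) * F (?e x)) has_integral (\<Sum>i\<in>UNIV. r i * F (p i))) {0..1}"
    if F: "F analytic_on cball 0 1" for r F
  proof -
    have "((\<lambda>x. \<Sum>i\<in>UNIV. r i * (cnj (k i (?e x)) * F (?e x))) has_integral (\<Sum>i\<in>UNIV. r i * F (p i))) {0..1}"
      unfolding k_def by (intro has_integral_sum has_integral_mult_right Szego_reproducing F p) auto
    then show ?thesis
      by (simp add: G_def sum_distrib_right mult.assoc)
  qed
  define y where "y i = A (p i) * s i + B (p i) * t i" for i
  define y' where "y' i = C (p i) * s i + D (p i) * t i" for i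
  define f where "f z = A z * G y z + C z * G y' z" for z
  define f' where "f' z = B z * G y z + D z * G y' z" for z
  have fan: "f analytic_on cball 0 1" "f' analytic_on cball 0 1"
    unfolding f_def f'_def by (intro analytic_intros an Gan)+
  \<comment> \<open>The reproducing property evaluates only integrals of cnj \<open>G\<close> times
    an analytic function, so |f|^2 cannot be integrated directly. Re (cnj g (g - 2 f)) = |g - f|^2 -
    |f|^2 hides it in an admissible integrand.\<close>
  define \<Phi> where "\<Phi> z = cnj (G s z) * (G s z - 2 * f z) + cnj (G t z) * (G t z - 2 * f' z)
     + cnj (G y z) * G y z + cnj (G y' z) * G y' z" for z
  define V where "V = (\<Sum>i\<in>UNIV. s i * (G s (p i) - 2 * f (p i))) + (\<Sum>i\<in>UNIV. t i * (G t (p i) - 2 * f' (p i)))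
     + (\<Sum>i\<in>UNIV. y i * G y (p i)) + (\<Sum>i\<in>UNIV. y' i * G y' (p i))"
  have "((\<lambda>x. \<Phi> (?e x)) has_integral V) {0..1}"
    unfolding \<Phi>_def V_def
    by (intro has_integral_add int Gan analytic_intros fan)
  then have "((\<lambda>x. Re (\<Phi> (?e x))) has_integral Re V) {0..1}"
    by (rule has_integral_Re)
  moreover have "0 \<le> Re (\<Phi> (?e x))" for x
  proof -
    have "?e x \<in> sphere 0 1"
      by (simp add: circlepath norm_exp_eq_Re)
    then have le: "(norm (f (?e x)))\<^sup>2 + (norm (f' (?e x)))\<^sup>2 \<le> (norm (G y (?e x)))\<^sup>2 + (norm (G y' (?e x)))\<^sup>2"
      unfolding f_def f'_def by (rule contr)
    have "Re (\<Phi> z) = (norm (G s z - f z))\<^sup>2 + (norm (G t z - f' z))\<^sup>2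
        + ((norm (G y z))\<^sup>2 + (norm (G y' z))\<^sup>2 - (norm (f z))\<^sup>2 - (norm (f' z))\<^sup>2)" for z
      unfolding \<Phi>_def cmod_power2 by (simp add: power2_eq_square algebra_simps)
    then show ?thesis using le by simp
  qed
  ultimately have "0 \<le> Re V"
    by (meson has_integral_nonneg)
  \<comment> \<open>The terms s_i f (p_i) + t_i f' (p_i) regroup into y_i G y (p_i) + y'_i G y'
    (p_i); subtracted twice, they reverse the sign of the last two sums.\<close>
  have "V = (\<Sum>i\<in>UNIV. s i * G s (p i) + t i * G t (p i) - y i * G y (p i) - y' i * G y' (p i))"
    unfolding V_def sum.distrib [symmetric]
    by (rule sum.cong) (auto simp: f_def f'_def y_def y'_def algebra_simps)
  also have "\<dots> = (\<Sum>i\<in>UNIV. \<Sum>j\<in>UNIV. (s i * cnj (s j) + t i * cnj (t j) - y i * cnj (y j) - y' i * cnj (y' j)) * k j (p i))"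
    unfolding G_def sum_distrib_left sum.distrib [symmetric] sum_subtractf [symmetric]
    by (intro sum.cong refl) (simp add: algebra_simps)
  also have "\<dots> = (\<Sum>j\<in>UNIV. \<Sum>i\<in>UNIV. (s i * cnj (s j) + t i * cnj (t j) - y i * cnj (y j) - y' i * cnj (y' j)) * k j (p i))"
    by (rule sum.swap)
  also have "\<dots> = pick_form p (\<lambda>i. A (p i)) (\<lambda>i. B (p i)) (\<lambda>i. C (p i)) (\<lambda>i. D (p i)) s t"
    unfolding pick_form_def k_def y_def y'_def by (intro sum.cong refl) (simp add: mult.commute)
  finally show ?thesis using \<open>0 \<le> Re V\<close> by simp
qed

text \<open>Vectors supported at one index leave only a diagonal block over 1 - |p_k|^2 > 0. This
  bounds the off-diagonal values at each node and so supplies the compactness for the passage to the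
  limit.\<close>

lemma pick_form_single:
  assumes "norm (p k) < 1" and "0 \<le> Re (pick_form p a b c d (\<lambda>i. if i = k then u else 0) (\<lambda>i. if i = k then v else 0))"
  shows "(norm (a k * u + b k * v))\<^sup>2 + (norm (c k * u + d k * v))\<^sup>2 \<le> (norm u)\<^sup>2 + (norm v)\<^sup>2"
proof -
  define E where "E = (norm u)\<^sup>2 + (norm v)\<^sup>2 - ((norm (a k * u + b k * v))\<^sup>2 + (norm (c k * u + d k * v))\<^sup>2)"
  define m where "m = 1 - (norm (p k))\<^sup>2"
  have m: "m > 0" using assms(1) by (simp add: m_def power_less_one_iff abs_square_less_1)
  have nn: "cnj z * z = of_real ((norm z)\<^sup>2)" for z
    by (metis complex_norm_square mult.commute)
  have eq: "(cnj u * u + cnj v * v - cnj (a k * u + b k * v) * (a k * u + b k * v)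
        - cnj (c k * u + d k * v) * (c k * u + d k * v)) / (1 - cnj (p k) * p k) = of_real (E / m)"
    unfolding nn by (simp add: E_def m_def)
  let ?s = "\<lambda>i. if i = k then u else 0" and ?t = "\<lambda>i. if i = k then v else 0"
  have *: "(cnj (?s i) * ?s j + cnj (?t i) * ?t j
          - cnj (a i * ?s i + b i * ?t i) * (a j * ?s j + b j * ?t j)
          - cnj (c i * ?s i + d i * ?t i) * (c j * ?s j + d j * ?t j)) / (1 - cnj (p i) * p j) =
      (if j = k then if i = k then of_real (E / m) else 0 else 0)" for i j
    using eq by (cases "i = k"; cases "j = k") simp_all
  have "pick_form p a b c d ?s ?t = of_real (E / m)"
    unfolding pick_form_def * by simp
  then have "0 \<le> E / m" using assms(2) by simp
  then have "0 \<le> E" using m by (simp add: zero_le_divide_iff)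
  then show ?thesis by (simp add: E_def)
qed

section \<open>Positive kernels through the nodes of an analytic function\<close>

text \<open>The functions X (r z) are analytic on the closed disc and inherit the nonvanishing
  condition. They take the old values X (p j) at the nodes p j / r, so only the denominators of the
  kernel change.\<close>

lemma exists_pick_data_scaled:
  fixes p :: "'n::finite \<Rightarrow> complex"
  assumes hol: "X1 holomorphic_on ball 0 1" "X2 holomorphic_on ball 0 1" "X3 holomorphic_on ball 0 1"
    and nv: "\<And>\<zeta> z w. norm \<zeta> < 1 \<Longrightarrow> norm z < 1 \<Longrightarrow> norm w < 1 \<Longrightarrow>
      1 - X1 \<zeta> * z - X2 \<zeta> * w + X3 \<zeta> * z * w \<noteq> 0"
    and r: "0 < r" "r < 1" and p: "\<And>j. norm (p j) < r"
    and nz: "\<And>z. norm z = r \<Longrightarrow> X1 z * X2 z \<noteq> X3 z"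
  shows "\<exists>b c. (\<forall>j. b j * c j = X1 (p j) * X2 (p j) - X3 (p j)) \<and>
     (\<forall>s t. 0 \<le> Re (pick_form (\<lambda>j. p j / of_real r) (\<lambda>j. X1 (p j)) b c (\<lambda>j. X2 (p j)) s t))"
proof -
  let ?r = "complex_of_real r"
  define h where "h z = X1 z * X2 z - X3 z" for z
  have holh: "h holomorphic_on ball 0 1" unfolding h_def by (intro holomorphic_intros hol)
  have in_ball: "norm (?r * z) < 1" if "norm z \<le> 1" for z
  proof -
    have "norm (?r * z) \<le> r * 1" using that r by (simp add: norm_mult)
    then show ?thesis using r by simp
  qed
  have an: "(\<lambda>z. F (?r * z)) analytic_on cball 0 1" if "F holomorphic_on ball 0 1" for F
  proof -
    have "F analytic_on ball 0 1" using that by (simp add: analytic_on_open)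
    then have "(F \<circ> (\<lambda>z. ?r * z)) analytic_on cball 0 1"
      by (intro analytic_on_compose_gen [where T = "ball 0 1"] analytic_intros) (use in_ball in auto)
    then show ?thesis by (simp add: o_def)
  qed
  have "finite {z \<in> cball 0 r. h z = 0}"
  proof (cases "h constant_on ball 0 1")
    case True
    then obtain k where k: "\<And>z. z \<in> ball 0 1 \<Longrightarrow> h z = k" by (auto simp: constant_on_def)
    have "h ?r = k" using k r by auto
    moreover have "h ?r \<noteq> 0" using nz [of ?r] r by (simp add: h_def)
    ultimately have "{z \<in> cball 0 r. h z = 0} = {}" using k r by auto
    then show ?thesis by (simp only: finite.emptyI)
  next
    case False
    then show ?thesis
      by (intro holomorphic_compact_finite_zeros [OF holh]) (use r in auto)
  qed
  then have "finite ((\<lambda>z. z / ?r) ` {z \<in> cball 0 r. h z = 0})" by (rule finite_imageI)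
  moreover have "{z \<in> cball 0 1. h (?r * z) = 0} \<subseteq> (\<lambda>z. z / ?r) ` {z \<in> cball 0 r. h z = 0}"
  proof
    fix z assume "z \<in> {z \<in> cball 0 1. h (?r * z) = 0}"
    then have "?r * z \<in> {z \<in> cball 0 r. h z = 0}" "z = (?r * z) / ?r"
      using r by (auto simp: norm_mult mult_left_le)
    then show "z \<in> (\<lambda>z. z / ?r) ` {z \<in> cball 0 r. h z = 0}" by blast
  qed
  ultimately have fin: "finite {z \<in> cball 0 1. h (?r * z) = 0}" by (rule finite_subset [rotated])
  have "balanced_factorable (\<lambda>z. h (?r * z))"
  proof (rule balanced_factorable_analytic [OF an [OF holh] fin])
    show "h (?r * z) \<noteq> 0" if "z \<in> sphere 0 1" for z
      using nz [of "?r * z"] that r by (simp add: h_def norm_mult)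
  qed
  then obtain b c where bc: "b analytic_on cball 0 1" "c analytic_on cball 0 1"
    "\<And>z. z \<in> cball 0 1 \<Longrightarrow> h (?r * z) = b z * c z" "\<And>z. z \<in> sphere 0 1 \<Longrightarrow> norm (b z) = norm (c z)"
    by (auto simp: balanced_factorable_def)
  define q where "q j = p j / ?r" for j
  have q: "norm (q j) < 1" "?r * q j = p j" for j
    using p [of j] r by (simp_all add: q_def norm_divide)
  have "0 \<le> Re (pick_form q (\<lambda>j. X1 (?r * q j)) (\<lambda>j. b (q j)) (\<lambda>j. c (q j)) (\<lambda>j. X2 (?r * q j)) s t)" for s t
  proof (rule pick_form_nonneg [OF an [OF hol(1)] bc(1,2) an [OF hol(2)]])
    fix z u v :: complex assume z: "z \<in> sphere 0 1"
    \<comment> \<open>Contractivity is required of the transpose, hence \<open>c\<close> in the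
      upper right corner.\<close>
    show "(norm (X1 (?r * z) * u + c z * v))\<^sup>2 + (norm (b z * u + X2 (?r * z) * v))\<^sup>2 \<le> (norm u)\<^sup>2 + (norm v)\<^sup>2"
    proof (rule balanced_contraction)
      show "norm (c z) = norm (b z)" using bc(4) [OF z] by simp
      have X3: "X1 (?r * z) * X2 (?r * z) - c z * b z = X3 (?r * z)"
        using bc(3) [of z] z by (simp add: h_def algebra_simps)
      show "1 - X1 (?r * z) * z' - X2 (?r * z) * w + (X1 (?r * z) * X2 (?r * z) - c z * b z) * z' * w \<noteq> 0"
        if "norm z' < 1" "norm w < 1" for z' w
        unfolding X3 using z by (intro nv that in_ball) auto
    qed
  qed (rule q)
  moreover have "b (q j) * c (q j) = X1 (p j) * X2 (p j) - X3 (p j)" for j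
    using bc(3) [of "q j"] q [of j] by (simp add: h_def)
  ultimately show ?thesis
    unfolding q(2) unfolding q_def by (intro exI conjI allI)
qed

text \<open>As the radius tends to 1 the factors need not converge as functions; only the finitely
  many numbers b_j, c_j are kept. They are bounded by 1, and the form is continuous in them and in
  the nodes.\<close>

lemma exists_pick_data:
  fixes p :: "'n::finite \<Rightarrow> complex"
  assumes hol: "X1 holomorphic_on ball 0 1" "X2 holomorphic_on ball 0 1" "X3 holomorphic_on ball 0 1"
    and nv: "\<And>\<zeta> z w. norm \<zeta> < 1 \<Longrightarrow> norm z < 1 \<Longrightarrow> norm w < 1 \<Longrightarrow>
      1 - X1 \<zeta> * z - X2 \<zeta> * w + X3 \<zeta> * z * w \<noteq> 0"
    and p: "\<And>j. norm (p j) < 1" and nz: "\<And>j. X1 (p j) * X2 (p j) \<noteq> X3 (p j)"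
  shows "\<exists>b c. (\<forall>j. b j * c j = X1 (p j) * X2 (p j) - X3 (p j)) \<and>
     (\<forall>s t. 0 \<le> Re (pick_form p (\<lambda>j. X1 (p j)) b c (\<lambda>j. X2 (p j)) s t))"
proof -
  define h where "h z = X1 z * X2 z - X3 z" for z
  have holh: "h holomorphic_on ball 0 1" unfolding h_def by (intro holomorphic_intros hol)
  have fin: "finite {z \<in> cball 0 x. h z = 0}" if x: "x < 1" for x
  proof (cases "h constant_on ball 0 1")
    case True
    then obtain k where k: "\<And>z. z \<in> ball 0 1 \<Longrightarrow> h z = k" by (auto simp: constant_on_def)
    \<comment> \<open>Index types are inhabited, so some node exists; \<open>undefined\<close> names
      one, and there \<open>h\<close> does not vanish.\<close>
    have "h z \<noteq> 0" if "z \<in> cball 0 x" for z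
      using k [of "p undefined"] k [of z] that x p [of undefined] nz [of undefined] by (auto simp: h_def)
    then have "{z \<in> cball 0 x. h z = 0} = {}" by blast
    then show ?thesis by (simp only: finite.emptyI)
  next
    case False
    then show ?thesis
      by (intro holomorphic_compact_finite_zeros [OF holh]) (use x in auto)
  qed
  define R where "R = Max (range (\<lambda>j. norm (p j)))"
  have R: "norm (p j) \<le> R" for j unfolding R_def by (intro Max_ge) auto
  have "R \<in> range (\<lambda>j. norm (p j))" unfolding R_def by (intro Max_in) auto
  then have R1: "0 \<le> R" "R < 1" using p by auto
  have "\<exists>r. max R (1 - 1 / real (Suc m)) < r \<and> r < 1 \<and> (\<forall>z. norm z = r \<longrightarrow> h z \<noteq> 0)" for m
  proof -
    \<comment> \<open>The radius must exceed every |p j|, tend to 1 with m, and avoid the finitely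
      many moduli of zeros of \<open>h\<close> up to the midpoint of \<open>?x\<close> and
      1.\<close>
    let ?x = "max R (1 - 1 / real (Suc m))" and ?Z = "{z \<in> cball 0 ((max R (1 - 1 / real (Suc m)) + 1) / 2). h z = 0}"
    have x: "?x < 1" using R1 by simp
    then have "infinite {?x <..< (?x + 1) / 2}" by (intro infinite_Ioo) simp
    moreover have "finite (norm ` ?Z)" using x by (intro finite_imageI fin) simp
    ultimately obtain r where "r \<in> {?x <..< (?x + 1) / 2}" "r \<notin> norm ` ?Z"
      by (meson finite_subset subsetI)
    then show ?thesis using x by (intro exI [of _ r]) auto
  qed
  then obtain r where r: "\<And>m. R < r m" "\<And>m. 1 - 1 / real (Suc m) < r m" "\<And>m. r m < 1"
    "\<And>m z. norm z = r m \<Longrightarrow> h z \<noteq> 0"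
    by (metis max_less_iff_conj)
  have r0: "0 < r m" for m using r(1) R1(1) by (meson le_less_trans)
  have lim_r: "r \<longlonglongrightarrow> 1"
  proof (rule tendsto_sandwich)
    show "(\<lambda>m. 1 - 1 / real (Suc m)) \<longlonglongrightarrow> 1"
      using tendsto_diff [OF tendsto_const [of 1] LIMSEQ_inverse_real_of_nat] by (simp add: inverse_eq_divide)
    show "\<forall>\<^sub>F m in sequentially. 1 - 1 / real (Suc m) \<le> r m"
      using r(2) by (intro always_eventually allI less_imp_le)
    show "\<forall>\<^sub>F m in sequentially. r m \<le> 1"
      using r(3) by (intro always_eventually allI less_imp_le)
  qed (rule tendsto_const)
  define q where "q m j = p j / complex_of_real (r m)" for m j
  have q1: "norm (q m j) < 1" for m j
    using le_less_trans [OF R r(1), of j m] r0 [of m] by (simp add: q_def norm_divide)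
  have "\<exists>b c. (\<forall>j. b j * c j = X1 (p j) * X2 (p j) - X3 (p j)) \<and>
     (\<forall>s t. 0 \<le> Re (pick_form (q m) (\<lambda>j. X1 (p j)) b c (\<lambda>j. X2 (p j)) s t))" for m
    unfolding q_def
  proof (rule exists_pick_data_scaled [OF hol nv r0 r(3)])
    show "norm (p j) < r m" for j using R r(1) by (rule le_less_trans)
    show "X1 z * X2 z \<noteq> X3 z" if "norm z = r m" for z using r(4) [OF that] by (simp add: h_def)
  qed
  then obtain b c where bc: "\<And>m j. b m j * c m j = X1 (p j) * X2 (p j) - X3 (p j)"
    and pos: "\<And>m s t. 0 \<le> Re (pick_form (q m) (\<lambda>j. X1 (p j)) (b m) (c m) (\<lambda>j. X2 (p j)) s t)"
    by metis
  have b1: "norm (b m j) \<le> 1" for m j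
  proof -
    have "(norm (b m j))\<^sup>2 + (norm (X2 (p j)))\<^sup>2 \<le> 1"
      using pick_form_single [OF q1 pos, where u = 0 and v = 1] by simp
    then have "(norm (b m j))\<^sup>2 \<le> 1\<^sup>2"
      using zero_le_power2 [of "norm (X2 (p j))"] unfolding one_power2 by linarith
    then show ?thesis by (rule power2_le_imp_le) simp
  qed
  have c1: "norm (c m j) \<le> 1" for m j
  proof -
    have "(norm (X1 (p j)))\<^sup>2 + (norm (c m j))\<^sup>2 \<le> 1"
      using pick_form_single [OF q1 pos, where u = 1 and v = 0] by simp
    then have "(norm (c m j))\<^sup>2 \<le> 1\<^sup>2"
      using zero_le_power2 [of "norm (X1 (p j))"] unfolding one_power2 by linarith
    then show ?thesis by (rule power2_le_imp_le) simp
  qed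
  \<comment> \<open>Collecting all values in one bounded sequence gives a subsequence common to
    every node and to both entries.\<close>
  define V :: "nat \<Rightarrow> (complex^'n) \<times> (complex^'n)" where "V m = (vec_lambda (b m), vec_lambda (c m))" for m
  have nle: "norm x \<le> real CARD('n)" if "\<And>j. norm (x $ j) \<le> 1" for x :: "complex^'n"
  proof -
    have "norm x \<le> (\<Sum>j\<in>UNIV. norm (x $ j))" unfolding norm_vec_def by (rule L2_set_le_sum) simp
    also have "\<dots> \<le> real CARD('n)" using sum_bounded_above [of UNIV "\<lambda>j. norm (x $ j)" 1] that by simp
    finally show ?thesis .
  qed
  have "norm (V m) \<le> real CARD('n) + real CARD('n)" for m
    unfolding V_def by (rule order_trans [OF norm_Pair_le add_mono]) (auto intro!: nle b1 c1)
  then have "bounded (range V)" by (auto simp: bounded_iff)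
  then obtain l f where f: "strict_mono f" and l: "(V \<circ> f) \<longlonglongrightarrow> l"
    using bounded_imp_convergent_subsequence by blast
  have limb: "(\<lambda>m. b (f m) j) \<longlonglongrightarrow> fst l $ j" for j
    using tendsto_vec_nth [OF tendsto_fst [OF l], of j] by (simp add: V_def o_def)
  have limc: "(\<lambda>m. c (f m) j) \<longlonglongrightarrow> snd l $ j" for j
    using tendsto_vec_nth [OF tendsto_snd [OF l], of j] by (simp add: V_def o_def)
  have limq: "(\<lambda>m. q (f m) j) \<longlonglongrightarrow> p j" for j
  proof -
    have "(\<lambda>m. complex_of_real (r (f m))) \<longlonglongrightarrow> of_real 1"
      using LIMSEQ_subseq_LIMSEQ [OF lim_r f] by (intro tendsto_of_real) (simp add: o_def)
    from tendsto_divide [OF tendsto_const [of "p j"] this] show ?thesis by (simp add: q_def)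
  qed
  have "0 \<le> Re (pick_form p (\<lambda>j. X1 (p j)) (\<lambda>j. fst l $ j) (\<lambda>j. snd l $ j) (\<lambda>j. X2 (p j)) s t)" for s t
  proof (rule LIMSEQ_le_const)
    show "(\<lambda>m. Re (pick_form (q (f m)) (\<lambda>j. X1 (p j)) (b (f m)) (c (f m)) (\<lambda>j. X2 (p j)) s t))
      \<longlonglongrightarrow> Re (pick_form p (\<lambda>j. X1 (p j)) (\<lambda>j. fst l $ j) (\<lambda>j. snd l $ j) (\<lambda>j. X2 (p j)) s t)"
      unfolding pick_form_def
      by (intro tendsto_intros limb limc limq one_minus_cnj_mult_nonzero p less_imp_le)
  qed (use pos in auto)
  moreover have "fst l $ j * snd l $ j = X1 (p j) * X2 (p j) - X3 (p j)" for j
    using LIMSEQ_unique [OF tendsto_mult [OF limb limc], of j] by (simp add: bc)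
  ultimately show ?thesis by blast
qed

section \<open>Positive matrices and contractive extensions\<close>

definition hermitian_form :: "('i::finite \<Rightarrow> 'i \<Rightarrow> complex) \<Rightarrow> ('i \<Rightarrow> complex) \<Rightarrow> complex" where
  "hermitian_form K v = (\<Sum>r\<in>UNIV. \<Sum>c\<in>UNIV. cnj (v r) * K r c * v c)"

text \<open>The form as a quadratic function of one coordinate. Suitable choices of \<open>s\<close>
  give the vanishing of rows with zero diagonal entry and the positivity of Schur
  complements.\<close>

lemma hermitian_form_perturb:
  "hermitian_form K (\<lambda>r. v r + (if r = a then s else 0)) =
     hermitian_form K v + cnj s * (\<Sum>c\<in>UNIV. K a c * v c) + s * (\<Sum>r\<in>UNIV. cnj (v r) * K r a)
       + cnj s * s * K a a"
proof -
  have "hermitian_form K (\<lambda>r. v r + (if r = a then s else 0)) =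
    (\<Sum>r\<in>UNIV. \<Sum>c\<in>UNIV. cnj (v r) * K r c * v c + (if r = a then cnj s * (K a c * v c) else 0)
       + (if c = a then s * (cnj (v r) * K r a) else 0)
       + (if r = a then if c = a then cnj s * s * K a a else 0 else 0))"
    unfolding hermitian_form_def
    by (intro sum.cong refl) (simp add: algebra_simps)
  also have "\<dots> = hermitian_form K v + (\<Sum>r\<in>UNIV. \<Sum>c\<in>UNIV. if r = a then cnj s * (K a c * v c) else 0)
       + (\<Sum>r\<in>UNIV. \<Sum>c\<in>UNIV. if c = a then s * (cnj (v r) * K r a) else 0)
       + (\<Sum>r\<in>UNIV. \<Sum>c\<in>UNIV. if r = a then if c = a then cnj s * s * K a a else 0 else 0)"
    by (simp only: sum.distrib hermitian_form_def)
  also have "(\<Sum>r\<in>UNIV. \<Sum>c\<in>UNIV. if r = a then cnj s * (K a c * v c) else 0) = cnj s * (\<Sum>c\<in>UNIV. K a c * v c)"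
    by (subst sum.swap) (simp add: sum_distrib_left)
  also have "(\<Sum>r\<in>UNIV. \<Sum>c\<in>UNIV. if c = a then s * (cnj (v r) * K r a) else 0) = s * (\<Sum>r\<in>UNIV. cnj (v r) * K r a)"
    by (simp add: sum_distrib_left)
  also have "(\<Sum>r\<in>UNIV. \<Sum>c\<in>UNIV. if r = a then if c = a then cnj s * s * K a a else 0 else 0) = cnj s * s * K a a"
    by (subst sum.swap) simp
  finally show ?thesis .
qed

lemma cnj_fixed_imp_of_real:
  assumes "z = cnj z"
  shows "z = of_real (Re z)"
  using assms by (metis Reals_cnj_iff of_real_Re)

lemma psd_diagonal:
  assumes "\<And>v. 0 \<le> Re (hermitian_form K v)"
  shows "0 \<le> Re (K a a)"
  \<comment> \<open>The summand 0 gives the basis vector the shape that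
    \<open>hermitian_form_perturb\<close> expands.\<close>
  using assms [of "\<lambda>r. 0 + (if r = a then 1 else 0)"]
  unfolding hermitian_form_perturb by (simp add: hermitian_form_def)

lemma psd_zero_diagonal:
  assumes herm: "\<And>r c. K r c = cnj (K c r)" and psd: "\<And>v. 0 \<le> Re (hermitian_form K v)"
    and "K a a = 0"
  shows "K a c = 0"
proof (rule ccontr)
  assume nz: "K a c \<noteq> 0"
  define x where "x = Re (K c c)"
  \<comment> \<open>With a zero diagonal entry the form is affine in \<open>t\<close>; this value
    makes it x - 2 (x + 1) = - x - 2, which is negative.\<close>
  define t where "t = - (x + 1) / (norm (K a c))\<^sup>2"
  define w :: "'a \<Rightarrow> complex" where "w r = 0 + (if r = c then 1 else 0)" for r
  have "hermitian_form K w = K c c"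
    unfolding w_def hermitian_form_perturb by (simp add: hermitian_form_def)
  moreover have "(\<Sum>d\<in>UNIV. K a d * w d) = K a c" by (simp add: w_def if_distrib cong: if_cong)
  moreover have "(\<Sum>r\<in>UNIV. cnj (w r) * K r a) = (\<Sum>r\<in>UNIV. if r = c then K c a else 0)"
    by (intro sum.cong) (auto simp: w_def)
  then have "(\<Sum>r\<in>UNIV. cnj (w r) * K r a) = K c a" by simp
  ultimately have "hermitian_form K (\<lambda>r. w r + (if r = a then of_real t * K a c else 0)) =
      K c c + of_real t * (cnj (K a c) * K a c) + of_real t * (K a c * K c a)"
    unfolding hermitian_form_perturb using assms(3) by simp
  also have "\<dots> = K c c + of_real (2 * t * (norm (K a c))\<^sup>2)"
    using herm [of c a] by (simp add: complex_norm_square algebra_simps del: of_real_power)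
  finally have "0 \<le> x + 2 * (t * (norm (K a c))\<^sup>2)"
    using psd by (metis (no_types, lifting) Re_complex_of_real mult.assoc plus_complex.sel(1) x_def)
  also have "t * (norm (K a c))\<^sup>2 = - (x + 1)" using nz by (simp add: t_def)
  finally have "x + 2 \<le> 0" by simp
  moreover have "0 \<le> x" unfolding x_def using psd by (rule psd_diagonal)
  ultimately show False by simp
qed

(* Elimination of one index at a time by the Schur complement. *)
lemma psd_kernel_gram_on:
  fixes K :: "'i::finite \<Rightarrow> 'i \<Rightarrow> complex"
  assumes "finite A" and "\<And>r c. K r c = cnj (K c r)" and "\<And>v. 0 \<le> Re (hermitian_form K v)"
    and "\<And>r c. r \<notin> A \<Longrightarrow> K r c = 0"
  shows "\<exists>v :: 'i \<Rightarrow> 'i \<Rightarrow> complex. \<forall>r c. K r c = (\<Sum>k\<in>A. cnj (v r k) * v c k)"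
  using assms
proof (induction A arbitrary: K rule: finite_induct)
  case empty
  then show ?case by simp
next
  case (insert a A)
  note herm = insert.prems(1) and psd = insert.prems(2) and outside = insert.prems(3)
  obtain \<kappa> :: real where \<kappa>: "K a a = of_real \<kappa>" "0 \<le> \<kappa>"
  proof
    show "K a a = of_real (Re (K a a))"
      by (rule cnj_fixed_imp_of_real [OF herm])
    show "0 \<le> Re (K a a)" using psd by (rule psd_diagonal)
  qed
  show ?case
  proof (cases "\<kappa> = 0")
    case True
    then have row0: "K a c = 0" for c using \<kappa> by (simp add: psd_zero_diagonal [OF herm psd])
    have "\<exists>v. \<forall>r c. K r c = (\<Sum>k\<in>A. cnj (v r k) * v c k)"
    proof (rule insert.IH [OF herm psd])
      show "K r c = 0" if "r \<notin> A" for r c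
        using that row0 outside by (cases "r = a") auto
    qed
    then obtain v where v: "\<forall>r c. K r c = (\<Sum>k\<in>A. cnj (v r k) * v c k)" ..
    \<comment> \<open>The induction hypothesis says nothing about coordinate \<open>a\<close> of
      \<open>v\<close>, so it is reset before the sum is extended.\<close>
    define w where "w r k = (if k = a then 0 else v r k)" for r k
    have "(\<Sum>k\<in>A. cnj (w r k) * w c k) = (\<Sum>k\<in>A. cnj (v r k) * v c k)" for r c
      using insert.hyps by (intro sum.cong) (auto simp: w_def)
    then have "K r c = (\<Sum>k\<in>insert a A. cnj (w r k) * w c k)" for r c
      using insert.hyps v by (simp add: w_def)
    then show ?thesis by blast
  next
    case False
    then have pos: "\<kappa> > 0" using \<kappa> by simp
    define K' where "K' r c = K r c - K r a * K a c / of_real \<kappa>" for r c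
    have herm': "K' r c = cnj (K' c r)" for r c
      unfolding K'_def using herm [of r c] herm [of r a] herm [of a c] by (simp add: mult.commute)
    have psd': "0 \<le> Re (hermitian_form K' v)" for v
    proof -
      define s where "s = (\<Sum>c\<in>UNIV. K a c * v c)"
      have s': "(\<Sum>r\<in>UNIV. cnj (v r) * K r a) = cnj s"
        unfolding s_def cnj_sum using herm [of _ a]
        by (intro sum.cong refl) (metis complex_cnj_cnj complex_cnj_mult mult.commute)
      have "hermitian_form K' v = hermitian_form K v - (\<Sum>r\<in>UNIV. cnj (v r) * K r a) * s / of_real \<kappa>"
        unfolding hermitian_form_def K'_def s_def sum_product sum_divide_distrib sum_subtractf [symmetric]
        by (intro sum.cong refl) (simp add: field_simps)
      also have "\<dots> = hermitian_form K v - cnj s * s / of_real \<kappa>" unfolding s' ..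
      \<comment> \<open>The Schur complement is the minimum of the form over coordinate
        \<open>a\<close>, attained at the shift - s / \<kappa>.\<close>
      also have "\<dots> = hermitian_form K (\<lambda>r. v r + (if r = a then - s / of_real \<kappa> else 0))"
        unfolding hermitian_form_perturb s' \<kappa>(1) s_def [symmetric]
        using pos by (simp add: field_simps)
      finally show ?thesis using psd by simp
    qed
    have "\<exists>v. \<forall>r c. K' r c = (\<Sum>k\<in>A. cnj (v r k) * v c k)"
    proof (rule insert.IH [OF herm' psd'])
      show "K' r c = 0" if "r \<notin> A" for r c
        using that outside \<kappa> pos by (cases "r = a") (auto simp: K'_def)
    qed
    then obtain v where v: "\<forall>r c. K' r c = (\<Sum>k\<in>A. cnj (v r k) * v c k)" ..
    define w where "w r k = (if k = a then K a r / of_real (sqrt \<kappa>) else v r k)" for r k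
    have "(\<Sum>k\<in>A. cnj (w r k) * w c k) = K' r c" for r c
      using insert.hyps by (subst v [rule_format], intro sum.cong) (auto simp: w_def)
    moreover have "cnj (w r a) * w c a = K r a * K a c / of_real \<kappa>" for r c
    proof -
      have "complex_of_real (sqrt \<kappa>) * of_real (sqrt \<kappa>) = of_real \<kappa>"
        using pos by (metis of_real_mult real_sqrt_mult_self abs_of_pos)
      then show ?thesis using herm [of r a] by (simp add: w_def)
    qed
    ultimately have "K r c = (\<Sum>k\<in>insert a A. cnj (w r k) * w c k)" for r c
      using insert.hyps by (simp add: K'_def)
    then show ?thesis by blast
  qed
qed

lemma positive_matrix_gram:
  fixes M :: "complex^'i^'i"
  assumes "positive_matrix M"
  obtains v :: "'i \<Rightarrow> complex^'i" where "\<And>r c. M $ r $ c = (\<Sum>k\<in>UNIV. cnj (v r $ k) * v c $ k)"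
proof -
  have "\<exists>v :: 'i \<Rightarrow> 'i \<Rightarrow> complex. \<forall>r c. M $ r $ c = (\<Sum>k\<in>UNIV. cnj (v r k) * v c k)"
  proof (rule psd_kernel_gram_on)
    show "M $ r $ c = cnj (M $ c $ r)" for r c
      using assms unfolding positive_matrix_def hermitian_def by blast
    show "0 \<le> Re (hermitian_form (\<lambda>r c. M $ r $ c) v)" for v
    proof -
      have "0 \<le> Re (\<Sum>i\<in>UNIV. \<Sum>j\<in>UNIV. cnj (vec_lambda v $ i) * M $ i $ j * vec_lambda v $ j)"
        using assms unfolding positive_matrix_def by blast
      then show ?thesis by (simp add: hermitian_form_def)
    qed
  qed auto
  then obtain v :: "'i \<Rightarrow> 'i \<Rightarrow> complex" where v: "\<forall>r c. M $ r $ c = (\<Sum>k\<in>UNIV. cnj (v r k) * v c k)" ..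
  show thesis
    by (rule that [of "\<lambda>r. vec_lambda (v r)"]) (simp add: v)
qed

text \<open>All rows are multiples of a single vector, so every 2 x 2 minor vanishes.\<close>

lemma rank_le_1_minor:
  fixes M :: "complex^'i^'j"
  assumes "rank M \<le> 1"
  shows "M $ r $ c * M $ r' $ c' = M $ r $ c' * M $ r' $ c"
proof -
  obtain B where B: "B \<subseteq> rows M" "vec.independent B" "rows M \<subseteq> vec.span B" "card B = vec.dim (rows M)"
    using vec.basis_exists by blast
  have "finite B" using B(2) vec.finiteI_independent by blast
  obtain b where "B \<subseteq> {b}"
  proof (cases "B = {}")
    case False
    have "card B \<le> 1" using assms B(4) by (simp add: row_rank_def_gen)
    then have "card B = 1" using False \<open>finite B\<close> by (metis card_0_eq le_antisym less_one not_le)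
    then show thesis using that by (metis card_1_singletonE order_refl)
  qed auto
  then have "rows M \<subseteq> vec.span {b}" using B(3) vec.span_mono by blast
  then have "\<exists>k. M $ r = k *s b" for r
    by (auto simp: rows_def row_def vec.span_singleton vec_nth_inverse)
  then obtain k where "\<And>r. M $ r = k r *s b" by metis
  then show ?thesis by simp
qed

text \<open>If the diagonal vanishes, so does N. Otherwise a row through a nonzero diagonal entry
  \<kappa>, divided by sqrt \<kappa>, is the factor, and the vanishing minors recover the remaining
  entries.\<close>

lemma positive_rank_1_factor:
  fixes N :: "complex^'i^'i"
  assumes pos: "positive_matrix N" and rk: "rank N \<le> 1"
  obtains g where "\<And>r c. N $ r $ c = cnj (g r) * g c"
proof -
  have herm: "N $ r $ c = cnj (N $ c $ r)" for r c
    using pos unfolding positive_matrix_def hermitian_def by blast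
  have psd: "0 \<le> Re (hermitian_form (\<lambda>r c. N $ r $ c) v)" for v
  proof -
    have "0 \<le> Re (\<Sum>i\<in>UNIV. \<Sum>j\<in>UNIV. cnj (vec_lambda v $ i) * N $ i $ j * vec_lambda v $ j)"
      using pos unfolding positive_matrix_def by blast
    then show ?thesis by (simp add: hermitian_form_def)
  qed
  show thesis
  proof (cases "\<exists>a. N $ a $ a \<noteq> 0")
    case False
    then have "N $ r $ c = 0" for r c
      using psd_zero_diagonal [where K = "\<lambda>r c. N $ r $ c", OF herm psd] by blast
    then show thesis by (intro that [of "\<lambda>_. 0"]) simp
  next
    case True
    then obtain a where a: "N $ a $ a \<noteq> 0" by blast
    define \<kappa> where "\<kappa> = Re (N $ a $ a)"
    have \<kappa>: "N $ a $ a = of_real \<kappa>" unfolding \<kappa>_def by (rule cnj_fixed_imp_of_real [OF herm])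
    have "0 \<le> \<kappa>" unfolding \<kappa>_def using psd by (rule psd_diagonal)
    then have "\<kappa> > 0" using a \<kappa> by (cases "\<kappa> = 0") auto
    then have sq: "complex_of_real (sqrt \<kappa>) * of_real (sqrt \<kappa>) = of_real \<kappa>"
      by (metis of_real_mult real_sqrt_mult_self abs_of_pos)
    show thesis
    proof (rule that [of "\<lambda>c. N $ a $ c / of_real (sqrt \<kappa>)"])
      fix r c
      have "cnj (N $ a $ r / of_real (sqrt \<kappa>)) * (N $ a $ c / of_real (sqrt \<kappa>)) = N $ r $ a * N $ a $ c / of_real \<kappa>"
        using herm [of r a] sq by simp
      also have "N $ r $ a * N $ a $ c = N $ r $ c * of_real \<kappa>"
        using rank_le_1_minor [OF rk] \<kappa> by metis
      finally show "N $ r $ c = cnj (N $ a $ r / of_real (sqrt \<kappa>)) * (N $ a $ c / of_real (sqrt \<kappa>))"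
        using \<open>\<kappa> > 0\<close> by simp
    qed
  qed
qed

lemma positive_matrix_outer:
  fixes g :: "'i::finite \<Rightarrow> complex"
  shows "positive_matrix (\<chi> r c. cnj (g r) * g c)" "rank (\<chi> r c. cnj (g r) * g c) \<le> 1"
proof -
  have "(\<Sum>i\<in>UNIV. \<Sum>j\<in>UNIV. cnj (v $ i) * (cnj (g i) * g j) * v $ j) =
      of_real ((norm (\<Sum>j\<in>UNIV. g j * v $ j))\<^sup>2)" for v :: "complex^'i"
    unfolding complex_norm_square cnj_sum
    by (subst mult.commute, unfold sum_product) (intro sum.cong refl, simp)
  then show "positive_matrix (\<chi> r c. cnj (g r) * g c)"
    by (simp add: positive_matrix_def hermitian_def)
  let ?M = "\<chi> r c. cnj (g r) * g c"
  have "row i ?M = cnj (g i) *s vec_lambda g" for i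
    by (simp add: row_def vec_eq_iff)
  then have "rows ?M \<subseteq> vec.span {vec_lambda g}"
    by (auto simp: rows_def vec.span_singleton)
  then show "rank ?M \<le> 1"
    unfolding row_rank_def_gen using vec.dim_le_card [of "rows ?M" "{vec_lambda g}"] by simp
qed

section \<open>Inner products and contractions with prescribed values\<close>

definition cinner :: "complex^'k \<Rightarrow> complex^'k \<Rightarrow> complex" where
  "cinner x y = (\<Sum>k\<in>UNIV. cnj (x $ k) * y $ k)"

lemma cinner_add_right: "cinner x (y + z) = cinner x y + cinner x z"
  by (simp add: cinner_def algebra_simps sum.distrib)

lemma cinner_diff_right: "cinner x (y - z) = cinner x y - cinner x z"
  by (simp add: cinner_def algebra_simps sum_subtractf)

lemma cinner_scale_right: "cinner x (c *s y) = c * cinner x y"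
  by (simp add: cinner_def sum_distrib_left algebra_simps)

lemma cnj_cinner: "cnj (cinner x y) = cinner y x"
  by (simp add: cinner_def mult.commute)

lemma cinner_add_left: "cinner (y + z) x = cinner y x + cinner z x"
  by (simp add: cinner_def algebra_simps sum.distrib)

lemma cinner_diff_left: "cinner (y - z) x = cinner y x - cinner z x"
  by (simp add: cinner_def algebra_simps sum_subtractf)

lemma cinner_scale_left: "cinner (c *s y) x = cnj c * cinner y x"
  by (simp add: cinner_def sum_distrib_left algebra_simps)

lemmas cinner_simps = cinner_add_right cinner_diff_right cinner_scale_right
  cinner_add_left cinner_diff_left cinner_scale_left

lemma cinner_self: "cinner x x = of_real ((norm x)\<^sup>2)"
proof -
  have "(norm x)\<^sup>2 = (\<Sum>k\<in>UNIV. (norm (x $ k))\<^sup>2)"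
    by (simp add: norm_vec_def L2_set_def sum_nonneg)
  then show ?thesis
    by (simp add: cinner_def complex_norm_square mult.commute del: of_real_power)
qed

lemma cinner_self_eq_0: "cinner x x = 0 \<longleftrightarrow> x = 0"
  by (simp add: cinner_self)

lemma vec_linearI:
  fixes f :: "'a::field^'k \<Rightarrow> 'a^'l"
  assumes "\<And>x y. f (x + y) = f x + f y" "\<And>c x. f (c *s x) = c *s f x"
  shows "Vector_Spaces.linear (*s) (*s) f"
  using assms by (simp add: Vector_Spaces.linear_iff vec.vector_space_axioms)

(* Gram-Schmidt elimination; the last conjunct, that the range of U lies in the
   span of the q r, is what makes the induction step orthogonal. *)
lemma gram_isometry_on:
  fixes p :: "'i \<Rightarrow> complex^'k" and q :: "'i \<Rightarrow> complex^'l"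
  assumes "finite A" and "\<And>r c. r \<in> A \<Longrightarrow> c \<in> A \<Longrightarrow> cinner (p r) (p c) = cinner (q r) (q c)"
  shows "\<exists>U. Vector_Spaces.linear (*s) (*s) U \<and> (\<forall>r\<in>A. U (p r) = q r) \<and> (\<forall>x. norm (U x) \<le> norm x) \<and>
    (\<forall>x y. (\<forall>r\<in>A. cinner y (q r) = 0) \<longrightarrow> cinner y (U x) = 0)"
  using assms
proof (induction A arbitrary: p q rule: finite_induct)
  case empty
  \<comment> \<open>The map starts as 0, so directions orthogonal to all \<open>p r\<close> are
    annihilated and the result is a contraction, not an isometry on the whole space.\<close>
  show ?case
    by (intro exI [of _ "\<lambda>_. 0"]) (auto intro: vec_linearI simp: cinner_def)
next
  case (insert a A)
  note gram = insert.prems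
  show ?case
  proof (cases "p a = 0")
    case True
    then have "q a = 0"
      using gram [of a a] cinner_self_eq_0 [of "p a"] cinner_self_eq_0 [of "q a"] by simp
    obtain U where U: "Vector_Spaces.linear (*s) (*s) U" "\<forall>r\<in>A. U (p r) = q r" "\<forall>x. norm (U x) \<le> norm x"
      "\<forall>x y. (\<forall>r\<in>A. cinner y (q r) = 0) \<longrightarrow> cinner y (U x) = 0"
      using insert.IH [of p q] gram by blast
    moreover have "U (p a) = q a" using vec.linear_0 [OF U(1)] True \<open>q a = 0\<close> by simp
    ultimately show ?thesis by blast
  next
    case False
    define \<kappa> where "\<kappa> = cinner (p a) (p a)"
    have \<kappa>q: "cinner (q a) (q a) = \<kappa>" using gram [of a a] by (simp add: \<kappa>_def)
    have \<kappa>0: "\<kappa> \<noteq> 0" using False by (simp add: \<kappa>_def cinner_self_eq_0)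
    define \<mu> where "\<mu> x = cinner (p a) x / \<kappa>" for x
    define p' where "p' r = p r - \<mu> (p r) *s p a" for r
    \<comment> \<open>The coefficient comes from the p side, but equality of the Gram matrices makes
      it also the coefficient of the projection of \<open>q r\<close> to \<open>q a\<close>.\<close>
    define q' where "q' r = q r - \<mu> (p r) *s q a" for r
    have gq: "cinner (q r) (q c) = cinner (p r) (p c)" if "r \<in> insert a A" "c \<in> insert a A" for r c
      using gram that by simp
    have "cinner (p' r) (p' c) = cinner (q' r) (q' c)" if "r \<in> A" "c \<in> A" for r c
      using that by (simp add: p'_def q'_def cinner_simps gq)
    then obtain U where U: "Vector_Spaces.linear (*s) (*s) U" "\<And>r. r \<in> A \<Longrightarrow> U (p' r) = q' r"
      "\<And>x. norm (U x) \<le> norm x"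
      "\<And>x y. (\<And>r. r \<in> A \<Longrightarrow> cinner y (q' r) = 0) \<Longrightarrow> cinner y (U x) = 0"
      using insert.IH [of p' q'] by metis
    have qa: "cinner (q a) (q' r) = 0" if "r \<in> A" for r
      using that \<kappa>0 by (simp add: q'_def cinner_simps gq \<mu>_def \<kappa>_def [symmetric])
    have Uqa: "cinner (q a) (U x) = 0" for x by (rule U(4) [OF qa])
    interpret U: Vector_Spaces.linear "(*s)" "(*s)" U by (rule U(1))
    define V where "V x = U (x - \<mu> x *s p a) + \<mu> x *s q a" for x
    have \<mu>_add: "\<mu> (x + y) = \<mu> x + \<mu> y" and \<mu>_scale: "\<mu> (c *s x) = c * \<mu> x" for x y c
      by (simp_all add: \<mu>_def cinner_simps add_divide_distrib)
    have lin: "Vector_Spaces.linear (*s) (*s) V"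
    proof (rule vec_linearI)
      fix x y :: "complex^'k" and c :: complex
      have "x + y - (\<mu> x + \<mu> y) *s p a = (x - \<mu> x *s p a) + (y - \<mu> y *s p a)"
        by (simp add: vec.scale_left_distrib)
      then show "V (x + y) = V x + V y"
        unfolding V_def \<mu>_add by (simp only: U.add vec.scale_left_distrib add_ac)
      have "c *s x - (c * \<mu> x) *s p a = c *s (x - \<mu> x *s p a)"
        by (simp add: vec.scale_right_diff_distrib)
      then show "V (c *s x) = c *s V x"
        unfolding V_def \<mu>_scale by (simp only: U.scale vec.scale_right_distrib vec.scale_scale)
    qed
    have Vp: "V (p r) = q r" if r: "r \<in> insert a A" for r
    proof (cases "r = a")
      case True
      have "\<mu> (p a) = 1" using \<kappa>0 by (simp add: \<mu>_def \<kappa>_def)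
      then show ?thesis using True U.zero by (simp add: V_def)
    next
      case False
      then show ?thesis using U(2) [of r] r by (simp add: V_def p'_def q'_def)
    qed
    have "norm (V x) \<le> norm x" for x
    proof -
      \<comment> \<open>Pythagoras before and after applying \<open>V\<close>: the component along
        \<open>p a\<close> contributes equally to both norms, so \<open>V\<close> loses at
        \<open>x\<close> exactly what \<open>U\<close> loses at \<open>y\<close>.\<close>
      define y where "y = x - \<mu> x *s p a"
      have x: "x = y + \<mu> x *s p a" by (simp add: y_def)
      have py: "cinner (p a) y = 0" using \<kappa>0 by (simp add: y_def cinner_simps \<mu>_def \<kappa>_def [symmetric])
      have yp: "cinner y (p a) = 0" using py cnj_cinner [of "p a" y] by simp
      have Uq: "cinner (U y) (q a) = 0" using Uqa [of y] cnj_cinner [of "q a" "U y"] by simp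
      have "complex_of_real ((norm (V x))\<^sup>2) = cinner (U y) (U y) + cnj (\<mu> x) * \<mu> x * \<kappa>"
        unfolding cinner_self [symmetric] V_def y_def [symmetric] by (simp add: cinner_simps Uqa Uq \<kappa>q)
      moreover have "complex_of_real ((norm x)\<^sup>2) = cinner y y + cnj (\<mu> x) * \<mu> x * \<kappa>"
        unfolding cinner_self [symmetric] by (subst (1 2) x) (simp add: cinner_simps py yp \<kappa>_def)
      ultimately have "complex_of_real ((norm x)\<^sup>2 - (norm (V x))\<^sup>2) = of_real ((norm y)\<^sup>2 - (norm (U y))\<^sup>2)"
        by (simp add: cinner_self)
      then have "(norm x)\<^sup>2 - (norm (V x))\<^sup>2 = (norm y)\<^sup>2 - (norm (U y))\<^sup>2"
        by (simp only: of_real_eq_iff)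
      moreover have "(norm (U y))\<^sup>2 \<le> (norm y)\<^sup>2" using U(3) by (intro power_mono) auto
      ultimately have "(norm (V x))\<^sup>2 \<le> (norm x)\<^sup>2" by linarith
      then show ?thesis by (rule power2_le_imp_le) simp
    qed
    moreover have "cinner y (V x) = 0" if y: "\<forall>r\<in>insert a A. cinner y (q r) = 0" for x y
    proof -
      have "cinner y (U z) = 0" for z
        using y by (intro U(4)) (simp add: q'_def cinner_simps)
      then show ?thesis using y by (simp add: V_def cinner_simps)
    qed
    ultimately show ?thesis using lin Vp by blast
  qed
qed

text \<open>Appending to \<open>q\<close> a Gram factor of the slack makes the Gram matrices equal.
  The map of the equality case, cut down to the first block, remains a contraction.\<close>

lemma gram_contraction:
  fixes p :: "'i::finite \<Rightarrow> complex^'k" and q :: "'i \<Rightarrow> complex^'l"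
  assumes "positive_matrix (\<chi> r c. cinner (p r) (p c) - cinner (q r) (q c))"
  obtains U :: "complex^'k^'l" where "\<And>r. U *v p r = q r" "\<And>x. norm (U *v x) \<le> norm x"
proof -
  obtain s :: "'i \<Rightarrow> complex^'i" where
    s: "\<And>r c. cinner (p r) (p c) - cinner (q r) (q c) = cinner (s r) (s c)"
    using positive_matrix_gram [OF assms] by (auto simp: cinner_def)
  define q' :: "'i \<Rightarrow> complex^('l + 'i)" where
    "q' r = (\<chi> k. case k of Inl l \<Rightarrow> q r $ l | Inr i \<Rightarrow> s r $ i)" for r
  have split: "(\<Sum>k\<in>UNIV. f k) = (\<Sum>l\<in>UNIV. f (Inl l)) + (\<Sum>i\<in>UNIV. f (Inr i))"
    for f :: "'l + 'i \<Rightarrow> 'c::comm_monoid_add"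
    using sum.Plus [of "UNIV :: 'l set" "UNIV :: 'i set" f] by (simp add: o_def)
  have "cinner (q' r) (q' c) = cinner (q r) (q c) + cinner (s r) (s c)" for r c
    unfolding cinner_def split by (simp add: q'_def)
  then have "cinner (p r) (p c) = cinner (q' r) (q' c)" for r c
    using s [of r c] by (simp add: algebra_simps)
  then obtain V where V: "Vector_Spaces.linear (*s) (*s) V" "\<And>r. V (p r) = q' r" "\<And>x. norm (V x) \<le> norm x"
    using gram_isometry_on [of UNIV p q'] by auto
  define U :: "complex^'k^'l" where "U = (\<chi> l. matrix V $ Inl l)"
  have U: "U *v x = (\<chi> l. V x $ Inl l)" for x
  proof -
    have "V x = matrix V *v x" by (rule matrix_works [OF V(1), symmetric])
    then show ?thesis by (simp only:) (simp add: U_def matrix_vector_mult_def vec_eq_iff)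
  qed
  show thesis
  proof
    show "U *v p r = q r" for r by (simp add: U V(2) q'_def vec_eq_iff)
    show "norm (U *v x) \<le> norm x" for x
    proof -
      have "(norm (U *v x))\<^sup>2 \<le> (norm (V x))\<^sup>2"
        unfolding norm_vec_def L2_set_def split U by (simp add: sum_nonneg)
      then have "norm (U *v x) \<le> norm (V x)" by (rule power2_le_imp_le) simp
      also have "\<dots> \<le> norm x" by (rule V(3))
      finally show ?thesis .
    qed
  qed
qed

section \<open>Determinantal realization\<close>

(* The matrix below is the transpose of 1 - U diag x, so that the
   dependence on x i is confined to row i, where det is linear. *)
definition char_det :: "complex^'k^'k \<Rightarrow> ('k \<Rightarrow> complex) \<Rightarrow> complex" where
  "char_det U x = det (\<chi> i. axis i 1 - x i *s column i U)"

lemma det_eq_0_rows: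
  fixes A :: "complex^'k^'k"
  shows "det A = 0 \<longleftrightarrow> (\<exists>y. y \<noteq> 0 \<and> (\<Sum>i\<in>UNIV. y $ i *s A $ i) = 0)"
proof -
  have "det A = 0 \<longleftrightarrow> \<not> invertible (transpose A)"
    by (metis det_transpose invertible_det_nz)
  also have "\<dots> \<longleftrightarrow> (\<exists>y. y \<noteq> 0 \<and> transpose A *v y = 0)"
    unfolding invertible_left_inverse matrix_left_invertible_ker by blast
  finally have "det A = 0 \<longleftrightarrow> (\<exists>y. y \<noteq> 0 \<and> transpose A *v y = 0)" .
  moreover have "transpose A *v y = (\<Sum>i\<in>UNIV. y $ i *s A $ i)" for y
    by (simp add: matrix_vector_mult_def transpose_def vec_eq_iff mult.commute)
  ultimately show ?thesis by simp
qed

lemma sum_scale_axis: "(\<Sum>i\<in>UNIV. y $ i *s axis i 1) = (y :: complex^'k)"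
  by (simp add: vec_eq_iff axis_def if_distrib cong: if_cong)

lemma sum_scale_column: "(\<Sum>i\<in>UNIV. x i *s column i U) = U *v (vec_lambda x)"
  for U :: "complex^'k^'l"
  by (simp add: vec_eq_iff column_def matrix_vector_mult_def mult.commute)

text \<open>A vanishing combination \<open>y\<close> of the rows means y = U w with w_i = x_i y_i,
  and \<open>w\<close> is strictly shorter than \<open>y\<close>.\<close>

lemma char_det_nonzero:
  fixes U :: "complex^'k^'k"
  assumes U: "\<And>y. norm (U *v y) \<le> norm y" and x: "\<And>i. norm (x i) < 1"
  shows "char_det U x \<noteq> 0"
proof
  assume "char_det U x = 0"
  then obtain y where y: "y \<noteq> 0" "(\<Sum>i\<in>UNIV. y $ i *s (axis i 1 - x i *s column i U)) = 0"
    unfolding char_det_def det_eq_0_rows by auto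
  define w where "w = (\<chi> i. y $ i * x i)"
  have "(\<Sum>i\<in>UNIV. y $ i *s (axis i 1 - x i *s column i U)) =
      (\<Sum>i\<in>UNIV. y $ i *s axis i 1) - (\<Sum>i\<in>UNIV. (y $ i * x i) *s column i U)"
    by (simp only: vec.scale_right_diff_distrib vec.scale_scale sum_subtractf)
  also have "\<dots> = y - U *v w" unfolding sum_scale_axis sum_scale_column w_def ..
  finally have "y = U *v w" using y by simp
  then have "norm y \<le> norm w" using U by metis
  moreover have "norm w < norm y"
  proof -
    obtain k where "y $ k \<noteq> 0" using y(1) by (auto simp: vec_eq_iff)
    then have "(norm (w $ k))\<^sup>2 < (norm (y $ k))\<^sup>2"
      using x [of k] by (intro power_strict_mono) (auto simp: w_def norm_mult)
    moreover have "(norm (w $ i))\<^sup>2 \<le> (norm (y $ i))\<^sup>2" for i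
      using x [of i] by (intro power_mono) (auto simp: w_def norm_mult intro!: mult_left_le)
    ultimately have "(\<Sum>i\<in>UNIV. (norm (w $ i))\<^sup>2) < (\<Sum>i\<in>UNIV. (norm (y $ i))\<^sup>2)"
      by (intro sum_strict_mono_ex1) auto
    then show ?thesis by (simp add: norm_vec_def L2_set_def)
  qed
  ultimately show False by simp
qed

text \<open>Multilinearity in row \<open>a\<close>, expressed through the determinants at x_a = 0
  and x_a = 1. The pair (1, z) gives affineness in x_a; the pair (q_a, 1) gives the interpolation
  identity.\<close>

lemma char_det_row:
  fixes U :: "complex^'k^'k"
  shows "det (\<chi> i. if i = a then s *s axis a 1 - t *s column a U else axis i 1 - x i *s column i U)
     = s * char_det U (x(a := 0)) + t * (char_det U (x(a := 1)) - char_det U (x(a := 0)))"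
proof -
  let ?c = "\<lambda>i. axis i 1 - x i *s column i U"
  let ?D = "\<lambda>r. det (\<chi> i. if i = a then r else ?c i)"
  have add: "?D (r + r') = ?D r + ?D r'" for r r'
    by (rule det_row_add [of a "\<lambda>_. r" "\<lambda>_. r'" ?c])
  have mul: "?D (k *s r) = k * ?D r" for k r
    by (rule det_row_mul [of a k "\<lambda>_. r" ?c])
  have lin: "?D (s *s axis a 1 - t *s column a U) = s * ?D (axis a 1) - t * ?D (column a U)" for s t
  proof -
    have "s *s axis a 1 - t *s column a U = s *s axis a 1 + (- t) *s column a U" by simp
    then show ?thesis by (simp only: add mul) simp
  qed
  have "char_det U (x(a := z)) = ?D (1 *s axis a 1 - z *s column a U)" for z
    unfolding char_det_def by (rule arg_cong [of _ _ det]) (simp add: vec_eq_iff)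
  then have cd: "char_det U (x(a := z)) = ?D (axis a 1) - z * ?D (column a U)" for z
    by (simp only: lin) simp
  show ?thesis
    unfolding cd lin by (simp add: algebra_simps)
qed

lemma char_det_affine:
  "char_det U (x(a := z)) = (1 - z) * char_det U (x(a := 0)) + z * char_det U (x(a := 1))"
proof -
  have "char_det U (x(a := z)) =
      det (\<chi> i. if i = a then 1 *s axis a 1 - z *s column a U else axis i 1 - x i *s column i U)"
    unfolding char_det_def by (rule arg_cong [of _ _ det]) (simp add: vec_eq_iff)
  also have "\<dots> = (1 - z) * char_det U (x(a := 0)) + z * char_det U (x(a := 1))"
    unfolding char_det_row by (simp add: algebra_simps)
  finally show ?thesis .
qed

text \<open>Feeding output i back through x_i for i \<noteq> a leaves the transfer function q_a =
  (D0 - D1) / D0, where D0, D1 are the determinants at x_a = 0, 1. It is stated without division and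
  proved by exhibiting \<open>q\<close>, with entry \<open>a\<close> replaced by 1, as a dependence
  between rows.\<close>

lemma char_det_interpolation:
  fixes U :: "complex^'k^'k" and p q :: "complex^'k"
  assumes Up: "U *v p = q" and pa: "p $ a = 1" and p: "\<And>i. i \<noteq> a \<Longrightarrow> p $ i = x i * q $ i"
  shows "q $ a * char_det U (x(a := 0)) + (char_det U (x(a := 1)) - char_det U (x(a := 0))) = 0"
proof -
  define A :: "complex^'k^'k" where
    "A = (\<chi> i. if i = a then (q $ a) *s axis a 1 - 1 *s column a U else axis i 1 - x i *s column i U)"
  define y :: "complex^'k" where "y = (\<chi> i. if i = a then 1 else q $ i)"
  have "y $ i *s A $ i = q $ i *s axis i 1 - p $ i *s column i U" for i
    using pa p [of i]
    by (cases "i = a") (simp_all add: y_def A_def vec.scale_right_diff_distrib mult.commute)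
  then have "(\<Sum>i\<in>UNIV. y $ i *s A $ i) = (\<Sum>i\<in>UNIV. q $ i *s axis i 1) - (\<Sum>i\<in>UNIV. p $ i *s column i U)"
    by (simp add: sum_subtractf)
  also have "\<dots> = 0" unfolding sum_scale_axis sum_scale_column using Up by simp
  finally have "(\<Sum>i\<in>UNIV. y $ i *s A $ i) = 0" .
  moreover have "y \<noteq> 0" by (auto simp: y_def vec_eq_iff intro!: exI [of _ a])
  ultimately have "det A = 0" unfolding det_eq_0_rows by blast
  then show ?thesis unfolding A_def char_det_row by simp
qed

text \<open>The Leibniz formula over the polynomial ring commutes with evaluation.\<close>

lemma char_det_poly:
  fixes U :: "complex^'k^'k" and P :: "'k \<Rightarrow> complex poly"
  shows "\<exists>R. \<forall>z. char_det U (\<lambda>i. poly (P i) z) = poly R z"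
proof -
  define A :: "complex poly^'k^'k" where
    "A = (\<chi> i j. [:axis i 1 $ j:] - P i * [:column i U $ j:])"
  have "char_det U (\<lambda>i. poly (P i) z) = poly (det A) z" for z
    unfolding char_det_def det_def A_def by (simp add: poly_sum poly_prod mult.commute)
  then show ?thesis by blast
qed

section \<open>Linear fractional maps determined by three values\<close>

lemma quadratic_three_zeros:
  fixes c0 c1 c2 :: complex
  assumes "\<And>k::3. c0 + c1 * z k + c2 * (z k)\<^sup>2 = 0" and "inj z"
  shows "c0 = 0" "c1 = 0" "c2 = 0"
proof -
  have e: "c0 + c1 * z 1 + c2 * (z 1)\<^sup>2 = 0" "c0 + c1 * z 2 + c2 * (z 2)\<^sup>2 = 0"
    "c0 + c1 * z 3 + c2 * (z 3)\<^sup>2 = 0" using assms(1) by blast+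
  have ne: "z 1 \<noteq> z 2" "z 1 \<noteq> z 3" "z 2 \<noteq> z 3"
    using inj_eq [OF assms(2), of 1 2] inj_eq [OF assms(2), of 1 3] inj_eq [OF assms(2), of 2 3] by auto
  have "(u - v) * (c1 + c2 * (u + v)) = (c0 + c1 * u + c2 * u\<^sup>2) - (c0 + c1 * v + c2 * v\<^sup>2)" for u v
    by (simp add: power2_eq_square algebra_simps)
  from this [of "z 1" "z 2"] this [of "z 1" "z 3"]
  have a: "c1 + c2 * (z 1 + z 2) = 0" and b: "c1 + c2 * (z 1 + z 3) = 0"
    using ne unfolding e by simp_all
  have "c2 * (z 2 - z 3) = (c1 + c2 * (z 1 + z 2)) - (c1 + c2 * (z 1 + z 3))"
    by (simp add: algebra_simps)
  then have "c2 * (z 2 - z 3) = 0" unfolding a b by simp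
  then show "c2 = 0" using ne by simp
  then show "c1 = 0" using a by simp
  then show "c0 = 0" using e(1) \<open>c2 = 0\<close> by simp
qed

text \<open>Cross-multiplication gives a polynomial of degree at most 2 with three distinct zeros,
  and its three coefficients determine Y1, Y2, Y3 once X1 X2 \<noteq> X3. The Y side is kept
  multiplied out, so its denominator may vanish.\<close>

lemma linear_fractional_unique:
  fixes z :: "3 \<Rightarrow> complex"
  assumes z: "inj z" and nz: "\<And>k. X2 * z k \<noteq> 1" and ndeg: "X1 * X2 \<noteq> X3"
    and eq: "\<And>k. (z k * X3 - X1) / (X2 * z k - 1) * (1 - Y2 * z k) = Y1 - Y3 * z k"
  shows "Y1 = X1" "Y2 = X2" "Y3 = X3"
proof -
  have "(Y1 - X1) + (X3 + X1 * Y2 - Y3 - Y1 * X2) * z k + (Y3 * X2 - X3 * Y2) * (z k)\<^sup>2 = 0" for k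
  proof -
    have "X2 * z k - 1 \<noteq> 0" using nz [of k] by simp
    then have "(z k * X3 - X1) * (1 - Y2 * z k) = (Y1 - Y3 * z k) * (X2 * z k - 1)"
      using eq [of k] by (simp add: field_simps)
    then show ?thesis by (simp add: power2_eq_square algebra_simps)
  qed
  from quadratic_three_zeros [OF this z]
  have c: "Y1 - X1 = 0" "X3 + X1 * Y2 - Y3 - Y1 * X2 = 0" "Y3 * X2 - X3 * Y2 = 0" by blast+
  show Y1: "Y1 = X1" using c(1) by simp
  have Y3: "Y3 = X3 + X1 * (Y2 - X2)" using c(2) Y1 by (simp add: algebra_simps)
  have "(Y2 - X2) * (X1 * X2 - X3) = 0" using c(3) unfolding Y3 by (simp add: algebra_simps)
  then show "Y2 = X2" using ndeg by simp
  then show "Y3 = X3" using Y3 by simp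
qed

section \<open>The equivalences\<close>

lemma det_one_minus_mult_diag:
  fixes A X :: "complex^2^2"
  assumes "X \<in> Diag"
  shows "det (mat 1 - A ** X) =
    1 - A $ 1 $ 1 * X $ 1 $ 1 - A $ 2 $ 2 * X $ 2 $ 2 + det A * X $ 1 $ 1 * X $ 2 $ 2"
proof -
  have "X $ 1 $ 2 = 0" "X $ 2 $ 1 = 0" using assms by (auto simp: Diag_def)
  then show ?thesis
    by (simp add: det_2 mat_def matrix_matrix_mult_def sum_2 algebra_simps)
qed

lemma norm_diag_entry_le_onorm:
  fixes X :: "complex^2^2"
  shows "norm (X $ k $ k) \<le> onorm ((*v) X)"
proof -
  have "norm (X $ k $ k) = norm ((X *v axis k 1) $ k)"
    by (simp add: matrix_vector_mult_def axis_def if_distrib cong: if_cong)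
  also have "\<dots> \<le> norm (X *v axis k 1)" by (rule Finite_Cartesian_Product.norm_nth_le)
  also have "\<dots> \<le> onorm ((*v) X) * norm (axis k (1::complex) :: complex^2)" by (rule onorm [OF matrix_vector_mul_bounded_linear])
  finally show ?thesis by (simp add: norm_axis_1)
qed

lemma onorm_diag_le:
  fixes X :: "complex^2^2"
  assumes "X \<in> Diag" "norm (X $ 1 $ 1) \<le> m" "norm (X $ 2 $ 2) \<le> m"
  shows "onorm ((*v) X) \<le> m"
proof (rule onorm_bound)
  show m: "0 \<le> m" using assms(2) norm_ge_zero order_trans by blast
  fix x :: "complex^2"
  have X: "X $ 1 $ 2 = 0" "X $ 2 $ 1 = 0" using assms(1) by (auto simp: Diag_def)
  have "(norm (X *v x))\<^sup>2 = (norm (X $ 1 $ 1 * x $ 1))\<^sup>2 + (norm (X $ 2 $ 2 * x $ 2))\<^sup>2"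
    by (simp add: norm_vec_def L2_set_def sum_2 matrix_vector_mult_def X)
  also have "\<dots> \<le> (m * norm (x $ 1))\<^sup>2 + (m * norm (x $ 2))\<^sup>2"
    unfolding norm_mult using assms by (intro add_mono power_mono mult_right_mono) auto
  also have "\<dots> = (m * norm x)\<^sup>2"
    by (simp add: norm_vec_def L2_set_def sum_2 power_mult_distrib algebra_simps)
  finally show "norm (X *v x) \<le> m * norm x"
    by (rule power2_le_imp_le) (use m in simp)
qed

lemma inverse_ennreal_le_1_iff: "inverse (x :: ennreal) \<le> 1 \<longleftrightarrow> 1 \<le> x"
proof (cases x)
  case (real r)
  show ?thesis
  proof (cases "r = 0")
    case False
    then show ?thesis using real by (simp add: inverse_ennreal ennreal_ge_1 inverse_le_1_iff)
  qed (use real in \<open>simp add: top_unique\<close>)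
qed simp

text \<open>The operator norm of a diagonal matrix is the larger modulus of its entries, so every
  singular \<open>mat 1 - A ** X\<close> has \<open>X\<close> of norm at least 1 precisely when the
  determinant has no zero in the open bidisc.\<close>

lemma mu_Diag_le_1_iff:
  "mu_Diag A \<le> 1 \<longleftrightarrow> (\<forall>z w. norm z < 1 \<longrightarrow> norm w < 1 \<longrightarrow>
     1 - A $ 1 $ 1 * z - A $ 2 $ 2 * w + det A * z * w \<noteq> 0)"
  (is "_ \<longleftrightarrow> ?R")
proof -
  let ?S = "{X\<in>Diag. \<not> invertible (mat 1 - A ** X)}"
  have S: "X \<in> ?S \<longleftrightarrow> X \<in> Diag \<and>
      1 - A $ 1 $ 1 * X $ 1 $ 1 - A $ 2 $ 2 * X $ 2 $ 2 + det A * X $ 1 $ 1 * X $ 2 $ 2 = 0" for X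
    using det_one_minus_mult_diag [of X A] by (auto simp: invertible_det_nz)
  have "mu_Diag A \<le> 1 \<longleftrightarrow> (\<forall>X\<in>?S. 1 \<le> ennreal (onorm ((*v) X)))"
    unfolding mu_Diag_def inverse_ennreal_le_1_iff by (simp add: le_INF_iff)
  also have "\<dots> \<longleftrightarrow> (\<forall>X\<in>?S. 1 \<le> onorm ((*v) X))"
    by (simp add: ennreal_ge_1)
  also have "\<dots> \<longleftrightarrow> ?R"
  proof
    assume L: "\<forall>X\<in>?S. 1 \<le> onorm ((*v) X)"
    show ?R
    proof (intro allI impI notI)
      fix z w assume zw: "norm z < 1" "norm w < 1"
        "1 - A $ 1 $ 1 * z - A $ 2 $ 2 * w + det A * z * w = 0"
      define X :: "complex^2^2" where "X = (\<chi> i j. if i = j then if i = 1 then z else w else 0)"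
      have X: "X \<in> Diag" "X $ 1 $ 1 = z" "X $ 2 $ 2 = w" by (auto simp: X_def Diag_def)
      then have "X \<in> ?S" using zw(3) unfolding S by simp
      then have "1 \<le> onorm ((*v) X)" using L by blast
      also have "\<dots> \<le> max (norm z) (norm w)" by (rule onorm_diag_le) (simp_all add: X)
      finally show False using zw by simp
    qed
  next
    assume R: ?R
    show "\<forall>X\<in>?S. 1 \<le> onorm ((*v) X)"
    proof (rule ballI, rule ccontr)
      fix X assume X: "X \<in> ?S" "\<not> 1 \<le> onorm ((*v) X)"
      then have "norm (X $ k $ k) < 1" for k using norm_diag_entry_le_onorm [of X k] by linarith
      then show False using R X(1) unfolding S by blast
    qed
  qed
  finally show ?thesis .
qed

lemma vector_in_closed_tetrablock_iff:
  "vector [a, d, s] \<in> closed_tetrablock \<longleftrightarrow>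
    (\<forall>z w. norm z < 1 \<longrightarrow> norm w < 1 \<longrightarrow> 1 - a * z - d * w + s * z * w \<noteq> 0)"
  by (auto simp: closed_tetrablock_def)

lemma pick_data_imp_lmi:
  fixes p x1 x2 x3 b c :: "'n::finite \<Rightarrow> complex"
  assumes p: "\<And>j. norm (p j) < 1" and x2: "\<And>j. norm (x2 j) \<le> 1"
    and bc: "\<And>j. b j * c j = x1 j * x2 j - x3 j"
    and pos: "\<And>s t. 0 \<le> Re (pick_form p x1 b c x2 s t)"
  shows "\<exists>z :: 3 \<Rightarrow> complex.
        inj z \<and> (\<forall>k. z k \<in> ball 0 1) \<and> (\<forall>j k. x2 j * z k \<noteq> 1) \<and>
        (\<exists>N M :: complex^('n \<times> 3)^('n \<times> 3).
          positive_matrix N \<and> rank N \<le> 1 \<and> positive_matrix M \<and>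
          loewner_ge
            (\<chi> r c. case (r, c) of ((i, l), (j, k)) \<Rightarrow>
               1 - cnj ((z l * x3 i - x1 i) / (x2 i * z l - 1)) *
                   ((z k * x3 j - x1 j) / (x2 j * z k - 1)))
            ((\<chi> r c. case (r, c) of ((i, l), (j, k)) \<Rightarrow>
               (1 - cnj (z l) * z k) * N $ (i, l) $ (j, k)) +
             (\<chi> r c. case (r, c) of ((i, l), (j, k)) \<Rightarrow>
               (1 - cnj (p i) * p j) * M $ (i, l) $ (j, k))))"
proof -
  \<comment> \<open>Any three distinct points of the disc serve; |x2| \<le> 1 keeps x2 z away from
    1.\<close>
  define z :: "3 \<Rightarrow> complex" where "z k = (if k = 1 then 0 else if k = 2 then 1 / 2 else 1 / 3)" for k
  have inj: "inj z" unfolding inj_def forall_3 by (simp add: z_def)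
  have zb: "norm (z k) < 1" for k by (simp add: z_def norm_divide)
  have nz: "1 - x2 j * z k \<noteq> 0" for j k
    using one_minus_cnj_mult_nonzero [of "cnj (z k)" "x2 j"] zb x2 by (simp add: mult.commute)
  \<comment> \<open>\<gamma> solves \<gamma> = c + x2 z \<gamma>, so S maps (1, z \<gamma>) to
    (\<psi>, \<gamma>).\<close>
  define \<gamma> where "\<gamma> r = c (fst r) / (1 - x2 (fst r) * z (snd r))" for r
  define \<psi> where "\<psi> r = (z (snd r) * x3 (fst r) - x1 (fst r)) / (x2 (fst r) * z (snd r) - 1)" for r
  define \<tau> where "\<tau> r = z (snd r) * \<gamma> r" for r
  have \<psi>: "x1 (fst r) + b (fst r) * \<tau> r = \<psi> r" for r
  proof -
    obtain j k where r: "r = (j, k)" by (cases r)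
    have ne: "1 - x2 j * z k \<noteq> 0" by (rule nz)
    have "\<psi> r = (x1 j - z k * x3 j) / (1 - x2 j * z k)"
      unfolding \<psi>_def r fst_conv snd_conv by (metis minus_diff_eq minus_divide_divide)
    also have "x1 j - z k * x3 j = x1 j * (1 - x2 j * z k) + z k * (b j * c j)"
      unfolding bc by (simp add: algebra_simps)
    also have "\<dots> / (1 - x2 j * z k) = x1 j + b j * \<tau> r"
      using ne by (simp add: \<tau>_def \<gamma>_def r add_divide_distrib mult_ac)
    finally show ?thesis by (simp add: r)
  qed
  have \<gamma>: "c (fst r) + x2 (fst r) * \<tau> r = \<gamma> r" for r
  proof -
    have "1 - x2 (fst r) * z (snd r) \<noteq> 0" by (rule nz)
    then show ?thesis by (simp add: \<tau>_def \<gamma>_def field_simps)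
  qed
  define n where "n r r' = 1 + cnj (\<tau> r) * \<tau> r' - cnj (\<psi> r) * \<psi> r' - cnj (\<gamma> r) * \<gamma> r'" for r r'
  define N :: "complex^('n \<times> 3)^('n \<times> 3)" where "N = (\<chi> r r'. cnj (\<gamma> r) * \<gamma> r')"
  define M :: "complex^('n \<times> 3)^('n \<times> 3)" where
    "M = (\<chi> r r'. n r r' / (1 - cnj (p (fst r)) * p (fst r')))"
  have "positive_matrix M"
    unfolding positive_matrix_def
  proof (intro conjI allI)
    show "hermitian M" by (simp add: hermitian_def M_def n_def mult.commute)
    fix v :: "complex^('n \<times> 3)"
    \<comment> \<open>Summing over the three points at each node turns the form of M into the Pick
      form at the vectors with entries S 1 and S \<tau>.\<close>
    define S where "S f i = (\<Sum>l\<in>UNIV. f (i, l) * v $ (i, l))" for f i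
    have prod: "cnj (S f i) * S f j = (\<Sum>l\<in>UNIV. \<Sum>k\<in>UNIV. cnj (v $ (i, l)) * (cnj (f (i, l)) * f (j, k)) * v $ (j, k))"
      for f i j
      unfolding S_def cnj_sum sum_product by (intro sum.cong refl) simp
    have pairs: "(\<Sum>r\<in>UNIV. h r) = (\<Sum>i\<in>UNIV. \<Sum>l\<in>UNIV. h (i, l))" for h :: "'n \<times> 3 \<Rightarrow> complex"
      unfolding UNIV_Times_UNIV [symmetric] sum.cartesian_product by simp
    have S\<psi>: "x1 i * S (\<lambda>_. 1) i + b i * S \<tau> i = S \<psi> i" for i
      unfolding S_def sum_distrib_left sum.distrib [symmetric]
      by (intro sum.cong refl) (simp add: \<psi> [symmetric] algebra_simps)
    have S\<gamma>: "c i * S (\<lambda>_. 1) i + x2 i * S \<tau> i = S \<gamma> i" for i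
      unfolding S_def sum_distrib_left sum.distrib [symmetric]
      by (intro sum.cong refl) (simp add: \<gamma> [symmetric] algebra_simps)
    have "(\<Sum>r\<in>UNIV. \<Sum>r'\<in>UNIV. cnj (v $ r) * M $ r $ r' * v $ r') =
        (\<Sum>i\<in>UNIV. \<Sum>j\<in>UNIV. \<Sum>l\<in>UNIV. \<Sum>k\<in>UNIV. cnj (v $ (i, l)) * M $ (i, l) $ (j, k) * v $ (j, k))"
      unfolding pairs by (intro sum.cong refl sum.swap)
    also have "\<dots> = (\<Sum>i\<in>UNIV. \<Sum>j\<in>UNIV. (cnj (S (\<lambda>_. 1) i) * S (\<lambda>_. 1) j + cnj (S \<tau> i) * S \<tau> j
        - cnj (S \<psi> i) * S \<psi> j - cnj (S \<gamma> i) * S \<gamma> j) / (1 - cnj (p i) * p j))"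
      unfolding prod sum.distrib [symmetric] sum_subtractf [symmetric] sum_divide_distrib
      by (intro sum.cong refl) (simp add: M_def n_def add_divide_distrib diff_divide_distrib algebra_simps)
    also have "\<dots> = pick_form p x1 b c x2 (S (\<lambda>_. 1)) (S \<tau>)"
      unfolding pick_form_def S\<psi> S\<gamma> ..
    finally show "0 \<le> Re (\<Sum>r\<in>UNIV. \<Sum>r'\<in>UNIV. cnj (v $ r) * M $ r $ r' * v $ r')"
      using pos by simp
  qed
  let ?P = "\<chi> r c. case (r, c) of ((i, l), (j, k)) \<Rightarrow>
     1 - cnj ((z l * x3 i - x1 i) / (x2 i * z l - 1)) * ((z k * x3 j - x1 j) / (x2 j * z k - 1))"
  let ?Q = "(\<chi> r c. case (r, c) of ((i, l), (j, k)) \<Rightarrow> (1 - cnj (z l) * z k) * N $ (i, l) $ (j, k)) +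
     (\<chi> r c. case (r, c) of ((i, l), (j, k)) \<Rightarrow> (1 - cnj (p i) * p j) * M $ (i, l) $ (j, k))"
  have P: "?P $ r $ r' = 1 - cnj (\<psi> r) * \<psi> r'" for r r'
    by (cases r; cases r') (simp add: \<psi>_def)
  \<comment> \<open>In the sum, |\<gamma>|^2 - |\<tau>|^2 from the N term cancels the \<tau> and
    \<gamma> terms of \<open>n\<close> (polarized), leaving 1 - cnj \<psi> \<psi>'.\<close>
  have "?Q $ r $ r' = 1 - cnj (\<psi> r) * \<psi> r'" for r r'
  proof -
    obtain i l j k where r: "r = (i, l)" "r' = (j, k)" by (cases r, cases r')
    have "1 - cnj (p i) * p j \<noteq> 0" by (intro one_minus_cnj_mult_nonzero p less_imp_le)
    then have "?Q $ r $ r' = (1 - cnj (z l) * z k) * (cnj (\<gamma> r) * \<gamma> r') + n r r'"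
      unfolding r by (simp add: N_def M_def)
    also have "\<dots> = 1 - cnj (\<psi> r) * \<psi> r'"
      unfolding n_def \<tau>_def r by (simp add: algebra_simps)
    finally show ?thesis .
  qed
  then have PQ: "?P = ?Q" unfolding vec_eq_iff P by simp
  have "hermitian ?P" unfolding hermitian_def P by (simp add: mult.commute)
  then have "loewner_ge ?P ?Q"
    unfolding loewner_ge_def PQ [symmetric] by (simp add: positive_matrix_def hermitian_def)
  moreover have "positive_matrix N" "rank N \<le> 1" unfolding N_def by (rule positive_matrix_outer)+
  moreover have "x2 j * z k \<noteq> 1" for j k using nz [of j k] by simp
  ultimately show ?thesis using inj zb \<open>positive_matrix M\<close> by (intro exI [of _ z] conjI exI [of _ N] exI [of _ M]) auto
qed

lemma lmi_imp_rational_interpolant: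
  fixes p x1 x2 x3 :: "'n::finite \<Rightarrow> complex" and z :: "3 \<Rightarrow> complex"
    and N M :: "complex^('n \<times> 3)^('n \<times> 3)"
  assumes p: "\<And>j. norm (p j) < 1" and ndeg: "\<And>j. x1 j * x2 j \<noteq> x3 j"
    and z: "inj z" "\<And>k. norm (z k) < 1" "\<And>j k. x2 j * z k \<noteq> 1"
    and N: "positive_matrix N" "rank N \<le> 1" and M: "positive_matrix M"
    and ge: "loewner_ge
            (\<chi> r c. case (r, c) of ((i, l), (j, k)) \<Rightarrow>
               1 - cnj ((z l * x3 i - x1 i) / (x2 i * z l - 1)) *
                   ((z k * x3 j - x1 j) / (x2 j * z k - 1)))
            ((\<chi> r c. case (r, c) of ((i, l), (j, k)) \<Rightarrow>
               (1 - cnj (z l) * z k) * N $ (i, l) $ (j, k)) +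
             (\<chi> r c. case (r, c) of ((i, l), (j, k)) \<Rightarrow>
               (1 - cnj (p i) * p j) * M $ (i, l) $ (j, k)))"
  shows "\<exists>x :: complex \<Rightarrow> complex^3.
        rational_vector_on x (ball 0 1) \<and> x ` ball 0 1 \<subseteq> closed_tetrablock \<and>
        (\<forall>j. x (p j) = vector [x1 j, x2 j, x3 j])"
proof -
  define \<psi> where "\<psi> j k = (z k * x3 j - x1 j) / (x2 j * z k - 1)" for j k
  obtain g where g: "\<And>r c. N $ r $ c = cnj (g r) * g c" using positive_rank_1_factor [OF N] by blast
  obtain v :: "'n \<times> 3 \<Rightarrow> complex^('n \<times> 3)" where v: "\<And>r c. M $ r $ c = cinner (v r) (v c)"
    using positive_matrix_gram [OF M] unfolding cinner_def by blast
  \<comment> \<open>The two Boolean slots are scalar: \<open>True\<close> carries input 1 and output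
    \<psi>, \<open>False\<close> carries the rank-one factor. The right summand carries the Gram
    vectors of M.\<close>
  define P :: "'n \<times> 3 \<Rightarrow> complex^(bool + 'n \<times> 3)" where
    "P r = (\<chi> \<kappa>. case \<kappa> of Inl e \<Rightarrow> if e then 1 else z (snd r) * g r | Inr i \<Rightarrow> p (fst r) * v r $ i)" for r
  define Q :: "'n \<times> 3 \<Rightarrow> complex^(bool + 'n \<times> 3)" where
    "Q r = (\<chi> \<kappa>. case \<kappa> of Inl e \<Rightarrow> if e then \<psi> (fst r) (snd r) else g r | Inr i \<Rightarrow> v r $ i)" for r
  have split: "(\<Sum>\<kappa>\<in>UNIV. f \<kappa>) = f (Inl True) + f (Inl False) + (\<Sum>i\<in>UNIV. f (Inr i))"
    for f :: "bool + 'n \<times> 3 \<Rightarrow> complex"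
  proof -
    have "(\<Sum>\<kappa>\<in>UNIV. f \<kappa>) = (\<Sum>e\<in>UNIV. f (Inl e)) + (\<Sum>i\<in>UNIV. f (Inr i))"
      using sum.Plus [of "UNIV :: bool set" "UNIV :: ('n \<times> 3) set" f] by (simp add: o_def)
    then show ?thesis by (simp add: UNIV_bool add.commute)
  qed
  have cP: "cinner (P r) (P r') = 1 + cnj (z (snd r)) * z (snd r') * (cnj (g r) * g r')
      + cnj (p (fst r)) * p (fst r') * cinner (v r) (v r')" for r r'
    unfolding cinner_def [of "P r"] split by (simp add: P_def cinner_def sum_distrib_left mult_ac)
  have cQ: "cinner (Q r) (Q r') = cnj (\<psi> (fst r) (snd r)) * \<psi> (fst r') (snd r') + cnj (g r) * g r'
      + cinner (v r) (v r')" for r r'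
    unfolding cinner_def [of "Q r"] split by (simp add: Q_def cinner_def)
  let ?A = "\<chi> r c. case (r, c) of ((i, l), (j, k)) \<Rightarrow>
     1 - cnj ((z l * x3 i - x1 i) / (x2 i * z l - 1)) * ((z k * x3 j - x1 j) / (x2 j * z k - 1))"
  let ?B = "(\<chi> r c. case (r, c) of ((i, l), (j, k)) \<Rightarrow> (1 - cnj (z l) * z k) * N $ (i, l) $ (j, k)) +
     (\<chi> r c. case (r, c) of ((i, l), (j, k)) \<Rightarrow> (1 - cnj (p i) * p j) * M $ (i, l) $ (j, k))"
  have "(?A - ?B) $ r $ r' = cinner (P r) (P r') - cinner (Q r) (Q r')" for r r'
  proof -
    obtain i l j k where r: "r = (i, l)" "r' = (j, k)" by (cases r, cases r')
    have "(?A - ?B) $ r $ r' = (1 - cnj (\<psi> i l) * \<psi> j k) -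
        ((1 - cnj (z l) * z k) * (cnj (g r) * g r') + (1 - cnj (p i) * p j) * cinner (v r) (v r'))"
      by (simp add: r g v \<psi>_def)
    then show ?thesis unfolding cP cQ by (simp add: r algebra_simps)
  qed
  then have "?A - ?B = (\<chi> r r'. cinner (P r) (P r') - cinner (Q r) (Q r'))"
    by (simp only: vec_eq_iff vec_lambda_beta) simp
  then have "positive_matrix (\<chi> r r'. cinner (P r) (P r') - cinner (Q r) (Q r'))"
    using ge unfolding loewner_ge_def by metis
  then obtain U where U: "\<And>r. U *v P r = Q r" "\<And>x. norm (U *v x) \<le> norm x"
    using gram_contraction by blast
  define pnt where "pnt s t \<zeta> = (\<lambda>\<kappa> :: bool + 'n \<times> 3. case \<kappa> of Inl e \<Rightarrow> if e then s else t | Inr _ \<Rightarrow> \<zeta>)"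
    for s t \<zeta> :: complex
  define D where "D s t \<zeta> = char_det U (pnt s t \<zeta>)" for s t \<zeta>
  have Dnz: "D s t \<zeta> \<noteq> 0" if "norm s < 1" "norm t < 1" "norm \<zeta> < 1" for s t \<zeta>
    unfolding D_def by (rule char_det_nonzero [OF U(2)]) (use that in \<open>auto simp: pnt_def split: sum.splits\<close>)
  have up1: "(pnt s t \<zeta>)(Inl True := s') = pnt s' t \<zeta>" for s t \<zeta> s'
    by (auto simp: pnt_def fun_eq_iff split: sum.splits)
  have up2: "(pnt s t \<zeta>)(Inl False := t') = pnt s t' \<zeta>" for s t \<zeta> t'
    by (auto simp: pnt_def fun_eq_iff split: sum.splits)
  have aff1: "D s t \<zeta> = (1 - s) * D 0 t \<zeta> + s * D 1 t \<zeta>" for s t \<zeta>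
    using char_det_affine [of U "pnt 0 t \<zeta>" "Inl True" s] unfolding up1 D_def .
  have aff2: "D s t \<zeta> = (1 - t) * D s 0 \<zeta> + t * D s 1 \<zeta>" for s t \<zeta>
    using char_det_affine [of U "pnt s 0 \<zeta>" "Inl False" t] unfolding up2 D_def .
  \<comment> \<open>Coefficients of the determinant as a polynomial affine in s and in t, read off
    at the corners 0, 1 and normalised to constant term 1. Only \<open>D 0 0\<close> is divided by,
    and it does not vanish on the disc.\<close>
  define y1 where "y1 \<zeta> = (D 0 0 \<zeta> - D 1 0 \<zeta>) / D 0 0 \<zeta>" for \<zeta>
  define y2 where "y2 \<zeta> = (D 0 0 \<zeta> - D 0 1 \<zeta>) / D 0 0 \<zeta>" for \<zeta>
  define y3 where "y3 \<zeta> = (D 1 1 \<zeta> - D 1 0 \<zeta> - D 0 1 \<zeta> + D 0 0 \<zeta>) / D 0 0 \<zeta>" for \<zeta>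
  have Dy: "D s t \<zeta> = D 0 0 \<zeta> * (1 - y1 \<zeta> * s - y2 \<zeta> * t + y3 \<zeta> * s * t)" if "norm \<zeta> < 1" for s t \<zeta>
  proof -
    have nz: "D 0 0 \<zeta> \<noteq> 0" by (rule Dnz) (use that in auto)
    have y: "D 0 0 \<zeta> * y1 \<zeta> = D 0 0 \<zeta> - D 1 0 \<zeta>" "D 0 0 \<zeta> * y2 \<zeta> = D 0 0 \<zeta> - D 0 1 \<zeta>"
      "D 0 0 \<zeta> * y3 \<zeta> = D 1 1 \<zeta> - D 1 0 \<zeta> - D 0 1 \<zeta> + D 0 0 \<zeta>"
      using nz by (simp_all add: y1_def y2_def y3_def)
    have "D 0 0 \<zeta> * (1 - y1 \<zeta> * s - y2 \<zeta> * t + y3 \<zeta> * s * t) =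
      D 0 0 \<zeta> - (D 0 0 \<zeta> * y1 \<zeta>) * s - (D 0 0 \<zeta> * y2 \<zeta>) * t + (D 0 0 \<zeta> * y3 \<zeta>) * s * t"
      by (simp add: algebra_simps)
    also have "\<dots> = D s t \<zeta>"
      unfolding y aff1 [of s t] aff2 [of 0 t] aff2 [of 1 t] by (simp add: algebra_simps)
    finally show ?thesis ..
  qed
  define x :: "complex \<Rightarrow> complex^3" where "x \<zeta> = vector [y1 \<zeta>, y2 \<zeta>, y3 \<zeta>]" for \<zeta>
  have "\<exists>R. \<forall>\<zeta>. D s t \<zeta> = poly R \<zeta>" for s t
  proof -
    have "pnt s t \<zeta> = (\<lambda>\<kappa>. poly (case \<kappa> of Inl e \<Rightarrow> if e then [:s:] else [:t:] | Inr _ \<Rightarrow> [:0, 1:]) \<zeta>)" for \<zeta>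
      by (auto simp: pnt_def fun_eq_iff split: sum.splits)
    then show ?thesis unfolding D_def by (simp only: char_det_poly)
  qed
  then obtain R where R: "\<And>s t \<zeta>. D s t \<zeta> = poly (R s t) \<zeta>" by metis
  have "rational_vector_on x (ball 0 1)"
    unfolding rational_vector_on_def forall_3
  proof (intro conjI)
    have nz: "poly (R 0 0) \<zeta> \<noteq> 0" if "\<zeta> \<in> ball 0 1" for \<zeta>
      using Dnz [of 0 0 \<zeta>] that by (simp add: R)
    show "\<exists>p q. \<forall>\<zeta>\<in>ball 0 1. poly q \<zeta> \<noteq> 0 \<and> x \<zeta> $ 1 = poly p \<zeta> / poly q \<zeta>"
      using nz by (intro exI [of _ "R 0 0 - R 1 0"] exI [of _ "R 0 0"]) (simp add: x_def y1_def R)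
    show "\<exists>p q. \<forall>\<zeta>\<in>ball 0 1. poly q \<zeta> \<noteq> 0 \<and> x \<zeta> $ 2 = poly p \<zeta> / poly q \<zeta>"
      using nz by (intro exI [of _ "R 0 0 - R 0 1"] exI [of _ "R 0 0"]) (simp add: x_def y2_def R)
    show "\<exists>p q. \<forall>\<zeta>\<in>ball 0 1. poly q \<zeta> \<noteq> 0 \<and> x \<zeta> $ 3 = poly p \<zeta> / poly q \<zeta>"
      using nz by (intro exI [of _ "R 1 1 - R 1 0 - R 0 1 + R 0 0"] exI [of _ "R 0 0"]) (simp add: x_def y3_def R)
  qed
  moreover have "x ` ball 0 1 \<subseteq> closed_tetrablock"
  proof (rule image_subsetI)
    fix \<zeta> :: complex assume "\<zeta> \<in> ball 0 1"
    then have \<zeta>: "norm \<zeta> < 1" by simp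
    show "x \<zeta> \<in> closed_tetrablock"
      unfolding x_def vector_in_closed_tetrablock_iff
    proof (intro allI impI)
      fix s t :: complex assume "norm s < 1" "norm t < 1"
      then have "D s t \<zeta> \<noteq> 0" using \<zeta> by (rule Dnz)
      then show "1 - y1 \<zeta> * s - y2 \<zeta> * t + y3 \<zeta> * s * t \<noteq> 0"
        using Dy [OF \<zeta>, of s t] by (metis mult_zero_right)
    qed
  qed
  moreover have "x (p j) = vector [x1 j, x2 j, x3 j]" for j
  proof -
    have "\<psi> j k * (1 - y2 (p j) * z k) = y1 (p j) - y3 (p j) * z k" for k
    proof -
      have nz: "D 0 0 (p j) \<noteq> 0" by (rule Dnz) (use p in auto)
      \<comment> \<open>At t = z_k and \<zeta> = p_j every slot of \<open>P (j, k)\<close> other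
        than \<open>True\<close> is the variable times the same slot of \<open>Q (j, k)\<close>, so
        the transfer function takes the value \<psi> there.\<close>
      have "Q (j, k) $ Inl True * char_det U ((pnt 0 (z k) (p j))(Inl True := 0)) +
          (char_det U ((pnt 0 (z k) (p j))(Inl True := 1)) - char_det U ((pnt 0 (z k) (p j))(Inl True := 0))) = 0"
        by (rule char_det_interpolation [OF U(1)]) (auto simp: P_def Q_def pnt_def split: sum.splits)
      then have "\<psi> j k * D 0 (z k) (p j) + (D 1 (z k) (p j) - D 0 (z k) (p j)) = 0"
        unfolding up1 D_def [symmetric] by (simp add: Q_def)
      then have "D 0 0 (p j) * (\<psi> j k * (1 - y2 (p j) * z k) - (y1 (p j) - y3 (p j) * z k)) = 0"
        unfolding Dy [OF p, of 0 "z k"] Dy [OF p, of 1 "z k"] by (simp add: algebra_simps)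
      then show ?thesis using nz by simp
    qed
    from linear_fractional_unique [OF z(1) z(3) ndeg this [unfolded \<psi>_def]]
    show ?thesis by (simp add: x_def)
  qed
  ultimately show ?thesis by blast
qed

section \<open>Matrix functions with prescribed diagonal and determinant\<close>

text \<open>The exponential of the Lagrange interpolant of logarithms of the values.\<close>

lemma nonvanishing_interpolant:
  fixes p w :: "'n::finite \<Rightarrow> complex"
  assumes p: "inj p" and w: "\<And>j. w j \<noteq> 0"
  obtains f where "f holomorphic_on UNIV" "\<And>z. f z \<noteq> 0" "\<And>j. f (p j) = w j"
proof -
  define L where "L j z = (\<Prod>i\<in>UNIV - {j}. (z - p i) / (p j - p i))" for j z
  define g where "g z = (\<Sum>j\<in>UNIV. Ln (w j) * L j z)" for z
  have L: "L j (p k) = (if j = k then 1 else 0)" for j k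
  proof (cases "j = k")
    case True
    then show ?thesis unfolding L_def by (auto intro!: prod.neutral simp: inj_eq [OF p])
  next
    case False
    then have "L j (p k) = 0" unfolding L_def by (intro prod_zero) auto
    then show ?thesis using False by simp
  qed
  have "g (p k) = Ln (w k)" for k
    unfolding g_def L by (simp add: if_distrib cong: if_cong)
  moreover have "g holomorphic_on UNIV"
    unfolding g_def L_def by (intro holomorphic_intros) (auto simp: inj_eq [OF p])
  ultimately show thesis
    using w by (intro that [of "\<lambda>z. exp (g z)"]) (auto intro!: holomorphic_intros)
qed

lemma rational_vector_on_imp_holomorphic:
  fixes x :: "complex \<Rightarrow> complex^'k"
  assumes "rational_vector_on x S"
  shows "(\<lambda>z. x z $ i) holomorphic_on S"
proof -
  obtain p q where pq: "\<And>z. z \<in> S \<Longrightarrow> poly q z \<noteq> 0" "\<And>z. z \<in> S \<Longrightarrow> x z $ i = poly p z / poly q z"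
    using assms unfolding rational_vector_on_def by metis
  have "(\<lambda>z. poly p z / poly q z) holomorphic_on S"
    using pq(1) by (intro holomorphic_intros) auto
  then show ?thesis using pq(2) by (metis (no_types, lifting) holomorphic_cong)
qed

lemma interpolant_imp_matrix_interpolant:
  fixes p :: "'n::finite \<Rightarrow> complex" and W :: "'n \<Rightarrow> complex^2^2" and x :: "complex \<Rightarrow> complex^3"
  assumes p: "inj p" and W: "\<And>j. W j $ 1 $ 1 * W j $ 2 $ 2 \<noteq> det (W j)"
    and hol: "\<And>i. (\<lambda>z. x z $ i) holomorphic_on ball 0 1" and E: "x ` ball 0 1 \<subseteq> closed_tetrablock"
    and xp: "\<And>j. x (p j) = vector [W j $ 1 $ 1, W j $ 2 $ 2, det (W j)]"
  shows "\<exists>F :: complex \<Rightarrow> complex^2^2.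
        analytic_matrix_on F (ball 0 1) \<and> (\<forall>j. F (p j) = W j) \<and>
        (\<forall>z\<in>ball 0 1. mu_Diag (F z) \<le> 1)"
proof -
  \<comment> \<open>The product of the off-diagonal entries is W_11 W_22 - det W, hence
    nonzero.\<close>
  have "W j $ 1 $ 2 \<noteq> 0" for j using W [of j] by (auto simp: det_2)
  then obtain f where f: "f holomorphic_on UNIV" "\<And>z. f z \<noteq> 0" "\<And>j. f (p j) = W j $ 1 $ 2"
    using nonvanishing_interpolant [OF p, of "\<lambda>j. W j $ 1 $ 2"] by blast
  have fB: "f holomorphic_on ball 0 1" using f(1) holomorphic_on_subset by blast
  define F :: "complex \<Rightarrow> complex^2^2" where
    "F z = vector [vector [x z $ 1, f z], vector [(x z $ 1 * x z $ 2 - x z $ 3) / f z, x z $ 2]]" for z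
  have F: "F z $ 1 $ 1 = x z $ 1" "F z $ 1 $ 2 = f z"
    "F z $ 2 $ 1 = (x z $ 1 * x z $ 2 - x z $ 3) / f z" "F z $ 2 $ 2 = x z $ 2" for z
    by (simp_all add: F_def)
  have det: "det (F z) = x z $ 3" for z
    using f(2) [of z] by (simp add: det_2 F)
  have "analytic_matrix_on F (ball 0 1)"
    unfolding analytic_matrix_on_def forall_2 F analytic_on_open [OF open_ball]
    by (intro conjI holomorphic_intros hol fB f(2))
  moreover have "F (p j) = W j" for j
    unfolding vec_eq_iff forall_2 F xp f(3)
    using f(2) [of "p j"] f(3) [of j] by (simp add: det_2)
  moreover have "mu_Diag (F z) \<le> 1" if "z \<in> ball 0 1" for z
  proof -
    have "x z \<in> closed_tetrablock" using E that by blast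
    then show ?thesis unfolding mu_Diag_le_1_iff F det by (auto simp: closed_tetrablock_def)
  qed
  ultimately show ?thesis by blast
qed

theorem theorem1p1:
  fixes pt :: "'n::finite \<Rightarrow> complex"
    and W :: "'n \<Rightarrow> complex^2^2"
    and x1 x2 x3 :: "'n \<Rightarrow> complex"
  assumes pt_disc: "\<And>j. pt j \<in> ball 0 1"
    and pt_distinct: "inj pt"
    and W_nontriangular: "\<And>j. W j $ 1 $ 1 * W j $ 2 $ 2 \<noteq> det (W j)"
    and x_eq: "\<And>j. (x1 j, x2 j, x3 j) = (W j $ 1 $ 1, W j $ 2 $ 2, det (W j))"
  defines "cond1 \<equiv>
      \<exists>F :: complex \<Rightarrow> complex^2^2.
        analytic_matrix_on F (ball 0 1) \<and> (\<forall>j. F (pt j) = W j) \<and>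
        (\<forall>z\<in>ball 0 1. mu_Diag (F z) \<le> 1)"
    and "cond2 \<equiv>
      \<exists>x :: complex \<Rightarrow> complex^3.
        rational_vector_on x (ball 0 1) \<and> x ` ball 0 1 \<subseteq> closed_tetrablock \<and>
        (\<forall>j. x (pt j) = vector [x1 j, x2 j, x3 j])"
    and "cond3 \<equiv>
      \<exists>z :: 3 \<Rightarrow> complex.
        inj z \<and> (\<forall>k. z k \<in> ball 0 1) \<and> (\<forall>j k. x2 j * z k \<noteq> 1) \<and>
        (\<exists>N M :: complex^('n \<times> 3)^('n \<times> 3).
          positive_matrix N \<and> rank N \<le> 1 \<and> positive_matrix M \<and>
          loewner_ge
            (\<chi> r c. case (r, c) of ((i, l), (j, k)) \<Rightarrow>
               1 - cnj ((z l * x3 i - x1 i) / (x2 i * z l - 1)) *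
                   ((z k * x3 j - x1 j) / (x2 j * z k - 1)))
            ((\<chi> r c. case (r, c) of ((i, l), (j, k)) \<Rightarrow>
               (1 - cnj (z l) * z k) * N $ (i, l) $ (j, k)) +
             (\<chi> r c. case (r, c) of ((i, l), (j, k)) \<Rightarrow>
               (1 - cnj (pt i) * pt j) * M $ (i, l) $ (j, k))))"
  shows "(cond1 \<longleftrightarrow> cond2) \<and> (cond2 \<longleftrightarrow> cond3)"
proof -
  have p: "norm (pt j) < 1" for j using pt_disc [of j] by simp
  have x: "x1 j = W j $ 1 $ 1" "x2 j = W j $ 2 $ 2" "x3 j = det (W j)" for j
    using x_eq [of j] by simp_all
  have ndeg: "x1 j * x2 j \<noteq> x3 j" for j using W_nontriangular unfolding x .
  have "cond3" if c: cond1
  proof -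
    obtain F :: "complex \<Rightarrow> complex^2^2" where F: "analytic_matrix_on F (ball 0 1)" "\<And>j. F (pt j) = W j"
      "\<And>z. z \<in> ball 0 1 \<Longrightarrow> mu_Diag (F z) \<le> 1"
      using c unfolding cond1_def by blast
    have hol: "(\<lambda>z. F z $ i $ j) holomorphic_on ball 0 1" for i j
      using F(1) unfolding analytic_matrix_on_def by (blast intro: analytic_imp_holomorphic)
    have nv: "1 - F \<zeta> $ 1 $ 1 * z - F \<zeta> $ 2 $ 2 * w + det (F \<zeta>) * z * w \<noteq> 0"
      if "norm \<zeta> < 1" "norm z < 1" "norm w < 1" for \<zeta> z w
      using F(3) [of \<zeta>] that unfolding mu_Diag_le_1_iff by simp
    have hdet: "(\<lambda>z. det (F z)) holomorphic_on ball 0 1"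
      unfolding det_2 by (intro holomorphic_intros hol)
    have "\<exists>b c. (\<forall>j. b j * c j = F (pt j) $ 1 $ 1 * F (pt j) $ 2 $ 2 - det (F (pt j))) \<and>
        (\<forall>s t. 0 \<le> Re (pick_form pt (\<lambda>j. F (pt j) $ 1 $ 1) b c (\<lambda>j. F (pt j) $ 2 $ 2) s t))"
      by (rule exists_pick_data [OF hol hol hdet]) (use nv p W_nontriangular F(2) in auto)
    then obtain b c where
      bc: "\<And>j. b j * c j = x1 j * x2 j - x3 j" and
      pos: "\<And>s t. 0 \<le> Re (pick_form pt x1 b c x2 s t)"
      unfolding F(2) x [symmetric] by blast
    \<comment> \<open>Otherwise z = 0, w = 1 / x2 would be a zero in the open bidisc.\<close>
    have "norm (x2 j) \<le> 1" for j
    proof (rule ccontr)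
      assume "\<not> norm (x2 j) \<le> 1"
      then have "norm (1 / x2 j) < 1" "x2 j \<noteq> 0" by (auto simp: norm_divide divide_simps)
      then show False using nv [OF p [of j], of 0 "1 / x2 j"] by (simp add: F(2) x)
    qed
    then show ?thesis
      unfolding cond3_def using p bc pos by (intro pick_data_imp_lmi)
  qed
  moreover have "cond2" if c: cond3
  proof -
    obtain z :: "3 \<Rightarrow> complex" and N M :: "complex^('n \<times> 3)^('n \<times> 3)" where
      z: "inj z" "\<And>k. norm (z k) < 1" "\<And>j k. x2 j * z k \<noteq> 1" and
      NM: "positive_matrix N" "rank N \<le> 1" "positive_matrix M"
        "loewner_ge
            (\<chi> r c. case (r, c) of ((i, l), (j, k)) \<Rightarrow>
               1 - cnj ((z l * x3 i - x1 i) / (x2 i * z l - 1)) *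
                   ((z k * x3 j - x1 j) / (x2 j * z k - 1)))
            ((\<chi> r c. case (r, c) of ((i, l), (j, k)) \<Rightarrow>
               (1 - cnj (z l) * z k) * N $ (i, l) $ (j, k)) +
             (\<chi> r c. case (r, c) of ((i, l), (j, k)) \<Rightarrow>
               (1 - cnj (pt i) * pt j) * M $ (i, l) $ (j, k)))"
      using c unfolding cond3_def mem_ball_0 by blast
    show ?thesis
      unfolding cond2_def by (rule lmi_imp_rational_interpolant [OF p ndeg z NM])
  qed
  moreover have "cond1" if c: cond2
  proof -
    obtain x :: "complex \<Rightarrow> complex^3" where "rational_vector_on x (ball 0 1)"
      "x ` ball 0 1 \<subseteq> closed_tetrablock" "\<And>j. x (pt j) = vector [W j $ 1 $ 1, W j $ 2 $ 2, det (W j)]"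
      using c unfolding cond2_def x by blast
    then show ?thesis
      unfolding cond1_def
      by (intro interpolant_imp_matrix_interpolant [OF pt_distinct W_nontriangular] rational_vector_on_imp_holomorphic)
  qed
  ultimately show ?thesis by blast
qed

end
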